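(* Let $X$ be a real Hilbert space, $n\ge2$, $p\ge1$, $m\ge1$, let $A_1,\dots,A_n$ be maximally monotone operators on $X$ and $B_1,\dots,B_p$ be $\beta$-cocoercive operators on $X$ ($\beta>0$) such that $\operatorname{zer}(\sum_{i=1}^nA_i+\sum_{i=1}^pB_i)\neq\varnothing$. Let $D=\operatorname{diag}(d_1,\dots,d_n)$ with $d_i>0$, $M\in\mathbb{R}^{n\times m}$, $N\in\mathbb{R}^{n\times n}$, $P\in\mathbb{R}^{n\times p}$, $R\in\mathbb{R}^{p\times n}$ satisfy: $\ker(M^* )=\mathbb{R}\mathbf{1}$; $P^*\mathbf{1}=\mathbf{1}$; $R\mathbf{1}=\mathbf{1}$; $2D-N-N^*-MM^*\succeq0$; $\sum_{i,j=1}^nN_{ij}=\sum_{i=1}^nd_i$; $N$ and $P$ are lower triangular with zeros on the diagonal and $R$ is lower triangular. For $\theta,\gamma>0$ let $\mathbf{x}^\gamma$, $T_{\theta,\gamma}$, $\mathbf{e}^\gamma$, and $Q_{\delta\gets\gamma}$ be as defined in the context. Let $(\theta_k)_{k\in\mathbb{N}}$ in $(0,+\infty)$ be bounded and separated from zero, let $(\lambda_k)_{k\in\mathbb{N}}$ in $(0,+\infty)$ be separated from zero, and let $\Gamma\subseteq(0,2\mu^{-1})$ with $\mu=\beta\|(P^*-R)(M^* )^\dagger\|^2$ (convention: $\mu^{-1}=+\infty$ if $\mu=0$). Let $(\gamma_k)_{k\in\mathbb{N}}$ in $\Gamma$ converge to some $\bar\gamma\in\Gamma$, with $\sum_{k\in\mathbb{N}}(\gamma_{k+1}-\gamma_k)_+<+\infty$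 and $\liminf_k(2-\gamma_k\mu-2\lambda_k\theta_k)>0$. Given $\mathbf{z}_0\in X^m$, define for all $k\in\mathbb{N}$ $$\mathbf{x}_k=\mathbf{x}^{\gamma_k}(\mathbf{z}_k),\qquad \mathbf{w}_k=\mathbf{z}_k-\lambda_k\theta_k\mathbf{M}^*\mathbf{x}_k,\qquad \mathbf{z}_{k+1}=Q_{\gamma_{k+1}\gets\gamma_k}\mathbf{w}_k.$$ Then $(\mathbf{z}_k)_{k\in\mathbb{N}}$ and $(\mathbf{w}_k)_{k\in\mathbb{N}}$ converge weakly to some $\bar{\mathbf{z}}\in\operatorname{Fix}T_{\liminf_k\theta_k,\bar\gamma}$, and $(\mathbf{x}_k)_{k\in\mathbb{N}}$ converges weakly to $\bar{\mathbf{x}}=(\bar x,\dots,\bar x)\in X^n$ such that $$\bar x=J_{\frac{\bar\gamma}{d_1}A_1}\Big(\frac1{d_1}(\mathbf{M}\bar{\mathbf{z}})_1\Big)\in\operatorname{zer}\Big(\sum_{i=1}^nA_i+\sum_{i=1}^pB_i\Big).$$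
   Context: $X^n$ carries the $\ell_2$ product norm. For a matrix $A$, $\mathbf{A}=A\otimes\mathrm{Id}$ acts on tuples by $(\mathbf{A}\mathbf{z})_i=\sum_jA_{ij}\mathbf{z}_j$, $A^*$ is the transpose, $A^\dagger$ the Moore–Penrose pseudo-inverse, $\mathbf{M}^\dagger=M^\dagger\otimes\mathrm{Id}$; matrix norms are operator (spectral) norms; $\mathbf{1}$ is the vector of ones of suitable dimension. A (possibly rectangular) matrix is lower triangular if its $(i,j)$ entry vanishes for $j>i$. $J_A=(\mathrm{Id}+A)^{-1}$, $\operatorname{zer}A=\{x:0\in Ax\}$, $\operatorname{Fix}T=\{x:Tx=x\}$, $(a)_+=\max\{a,0\}$. A positive sequence is separated from zero if bounded below by a positive constant. $B:X\to X$ is $\beta$-cocoercive (paper's convention) if $\langle Bx-By,x-y\rangle\ge\frac1\beta\|Bx-By\|^2$ for all $x,y$. The map $\mathbf{x}^\gamma=(\mathbf{x}^\gamma_1,\dots,\mathbf{x}^\gamma_n):X^m\to X^n$ is defined recursively by $\mathbf{x}^\gamma_1(\mathbf{z})=J_{\frac{\gamma}{d_1}A_1}\big(\frac1{d_1}(\mathbf{M}\mathbf{z})_1\big)$ and, for $i=2,\dots,n$, $$\mathbf{x}^\gamma_i(\mathbf{z})=J_{\frac{\gamma}{d_i}A_i}\Big(\tfrac1{d_i}(\mathbf{M}\mathbf{z})_i+\tfrac1{d_i}\sum_{j=1}^{i-1}N_{ij}\mathbf{x}^\gamma_j(\mathbf{z})-\tfrac{\gamma}{d_i}\sum_{j=1}^{\min\{i-1,p\}}P_{ij}B_j\Big(\sum_{t=1}^{j}R_{jt}\mathbf{x}^\gamma_t(\mathbf{z})\Big)\Big).$$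 $T_{\theta,\gamma}:X^m\to X^m$ is $T_{\theta,\gamma}\mathbf{z}=\mathbf{z}-\theta\mathbf{M}^*\mathbf{x}^\gamma(\mathbf{z})$. The map $\mathbf{e}^\gamma:X^m\to X^n$ is $\mathbf{e}^\gamma(\mathbf{z})=P_{\operatorname{range}(\mathbf{M})}\big(d_i\mathbf{x}^\gamma_i(\mathbf{z})-\sum_{j=1}^{i-1}N_{ij}\mathbf{x}^\gamma_j(\mathbf{z})\big)_{i=1}^n$, with $P_{\operatorname{range}(\mathbf{M})}$ the orthogonal projection onto $\operatorname{range}(\mathbf{M})=\{\mathbf{y}\in X^n:\sum_i\mathbf{y}_i=0\}$. For $\gamma,\delta>0$, $Q_{\delta\gets\gamma}:X^m\to X^m$ is $Q_{\delta\gets\gamma}\mathbf{z}=\frac\delta\gamma\mathbf{z}+(1-\frac\delta\gamma)\mathbf{M}^\dagger\mathbf{e}^\gamma(\mathbf{z})$. *)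

theory Defs
  imports "HOL-Analysis.Analysis" "HOL-Library.Set_Algebras"
begin

section \<open>Index types\<close>

text \<open>
  The index set \<open>{1,\<dots>,n}\<close> is represented by a finite linearly ordered type with \<open>n\<close> elements, so that
  \<open>X\<^sup>n\<close> is the type \<open>('a, 'n) vec\<close> with its Euclidean product norm and an \<open>n \<times> m\<close> real matrix has
  type \<open>('n, 'm) rmat\<close>, rows first. The number of an index, counted from 1, also allows
  indices of two different index types to be compared.
\<close>

definition idx :: "'n::{finite,linorder} \<Rightarrow> nat" where
  "idx i = card {j. j \<le> i}"

lemma idx_less_iff: "idx i < idx j \<longleftrightarrow> i < j"
proof -
  have mono: "idx a < idx b" if "a < b" for a b :: 'a
  proof -
    have "b \<in> {j. j \<le> b}" "b \<notin> {j. j \<le> a}" "{j. j \<le> a} \<subseteq> {j. j \<le> b}"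
      using that by auto
    then have "{j. j \<le> a} \<subset> {j. j \<le> b}"
      by blast
    then show ?thesis
      unfolding idx_def by (intro psubset_card_mono) auto
  qed
  show ?thesis
    using mono[of i j] mono[of j i] by (cases i j rule: linorder_cases) auto
qed

lemma bij_betw_idx: "bij_betw idx (UNIV :: 'n::{finite,linorder} set) {1..CARD('n)}"
proof -
  have inj: "inj (idx :: 'n \<Rightarrow> nat)"
    by (rule injI) (metis idx_less_iff less_irrefl linorder_neqE)
  have sub: "range (idx :: 'n \<Rightarrow> nat) \<subseteq> {1..CARD('n)}"
  proof clarify
    fix i :: 'n
    have "i \<in> {j. j \<le> i}"
      by simp
    then have "0 < card {j. j \<le> i}"
      by (metis card_gt_0_iff empty_iff finite)
    moreover have "card {j. j \<le> i} \<le> CARD('n)"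
      by (rule card_mono) auto
    ultimately show "idx i \<in> {1..CARD('n)}"
      by (simp add: idx_def)
  qed
  have "range (idx :: 'n \<Rightarrow> nat) = {1..CARD('n)}"
    by (rule card_subset_eq[OF _ sub]) (simp_all add: card_image[OF inj])
  with inj show ?thesis
    by (simp add: bij_betw_def)
qed

section \<open>Matrices\<close>

type_synonym 'n rvec = "(real, 'n) vec"
type_synonym ('r, 'c) rmat = "((real, 'c) vec, 'r) vec"

definition lower_triangular :: "('r::{finite,linorder}, 'c::{finite,linorder}) rmat \<Rightarrow> bool" where
  "lower_triangular L \<longleftrightarrow> (\<forall>i j. idx i < idx j \<longrightarrow> L $ i $ j = 0)"

definition zero_diagonal :: "('r::{finite,linorder}, 'c::{finite,linorder}) rmat \<Rightarrow> bool" where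
  "zero_diagonal L \<longleftrightarrow> (\<forall>i j. idx i = idx j \<longrightarrow> L $ i $ j = 0)"

definition diag_mat :: "real ^ 'n \<Rightarrow> real ^ 'n ^ 'n" where
  "diag_mat d = (\<chi> i j. if i = j then d $ i else 0)"

definition pos_semidef :: "real ^ 'n ^ 'n \<Rightarrow> bool" where
  "pos_semidef S \<longleftrightarrow> transpose S = S \<and> (\<forall>v. 0 \<le> v \<bullet> (S *v v))"

text \<open>The Moore--Penrose pseudo-inverse, the unique solution of the four Penrose equations.\<close>

definition pinv :: "real ^ 'm ^ 'n \<Rightarrow> real ^ 'n ^ 'm" where
  "pinv K = (THE G. K ** G ** K = K \<and> G ** K ** G = G
     \<and> transpose (K ** G) = K ** G \<and> transpose (G ** K) = G ** K)"

definition spectral_norm :: "real ^ 'm ^ 'n \<Rightarrow> real" where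
  "spectral_norm K = onorm (\<lambda>v. K *v v)"

text \<open>The operator \<open>K \<otimes> Id\<close> from \<open>X\<^sup>m\<close> to \<open>X\<^sup>n\<close>.\<close>

definition tensor_Id :: "real ^ 'm ^ 'n \<Rightarrow> ('a::real_vector) ^ 'm \<Rightarrow> 'a ^ 'n" where
  "tensor_Id K z = (\<chi> i. \<Sum>j\<in>UNIV. K $ i $ j *\<^sub>R z $ j)"

section \<open>Operators on Hilbert spaces\<close>

definition monotone_op :: "('a::real_inner \<Rightarrow> 'a set) \<Rightarrow> bool" where
  "monotone_op A \<longleftrightarrow> (\<forall>x y. \<forall>u\<in>A x. \<forall>v\<in>A y. 0 \<le> (x - y) \<bullet> (u - v))"

definition maximally_monotone :: "('a::real_inner \<Rightarrow> 'a set) \<Rightarrow> bool" where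
  "maximally_monotone A \<longleftrightarrow>
     monotone_op A \<and> (\<forall>A'. monotone_op A' \<and> (\<forall>x. A x \<subseteq> A' x) \<longrightarrow> A' = A)"

definition cocoercive :: "real \<Rightarrow> ('a::real_inner \<Rightarrow> 'a) \<Rightarrow> bool" where
  "cocoercive \<beta> B \<longleftrightarrow> (\<forall>x y. (B x - B y) \<bullet> (x - y) \<ge> 1 / \<beta> * (norm (B x - B y))\<^sup>2)"

definition scale_op :: "real \<Rightarrow> ('a::real_vector \<Rightarrow> 'a set) \<Rightarrow> 'a \<Rightarrow> 'a set" where
  "scale_op c A x = (\<lambda>u. c *\<^sub>R u) ` A x"

text \<open>
  The value at \<open>y\<close> of the set-valued inverse of \<open>Id + A\<close> is \<open>{x. y \<in> {x} + A x}\<close>;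
  it is a singleton for every \<open>y\<close> if \<open>A\<close> is maximally monotone (Minty).
\<close>

definition resolvent :: "('a::real_inner \<Rightarrow> 'a set) \<Rightarrow> 'a \<Rightarrow> 'a" where
  "resolvent A y = (THE x. y \<in> {x} + A x)"

definition zer :: "('a::zero \<Rightarrow> 'a set) \<Rightarrow> 'a set" where
  "zer A = {x. 0 \<in> A x}"

text \<open>The sums of operator values below are Minkowski sums of sets.\<close>

definition sum_op :: "('n::finite \<Rightarrow> 'a::real_inner \<Rightarrow> 'a set) \<Rightarrow> ('p::finite \<Rightarrow> 'a \<Rightarrow> 'a) \<Rightarrow> 'a \<Rightarrow> 'a set"
  where "sum_op A B x = (\<Sum>i\<in>UNIV. A i x) + {\<Sum>j\<in>UNIV. B j x}"

definition Fix :: "('b \<Rightarrow> 'b) \<Rightarrow> 'b set" where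
  "Fix T = {x. T x = x}"

definition orth_proj :: "('b::real_inner) set \<Rightarrow> 'b \<Rightarrow> 'b" where
  "orth_proj S y = (THE q. q \<in> S \<and> (\<forall>s\<in>S. orthogonal (y - q) s))"

definition weakly_convergent_to :: "(nat \<Rightarrow> 'b::real_inner) \<Rightarrow> 'b \<Rightarrow> bool" where
  "weakly_convergent_to x l \<longleftrightarrow> (\<forall>y. (\<lambda>k. x k \<bullet> y) \<longlonglongrightarrow> l \<bullet> y)"

definition separated_from_zero :: "(nat \<Rightarrow> real) \<Rightarrow> bool" where
  "separated_from_zero a \<longleftrightarrow> (\<exists>c>0. \<forall>k. c \<le> a k)"

section \<open>The algorithmic maps\<close>

text \<open>
  For the first index both sums over previous indices are empty. Since \<open>idx j\<close> never exceeds
  \<open>CARD('p)\<close>, the condition \<open>idx j < idx i\<close> expresses \<open>j \<le> min {i - 1, p}\<close>.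
\<close>

function xcomp ::
  "('n::{finite,linorder} \<Rightarrow> 'a::real_inner \<Rightarrow> 'a set) \<Rightarrow> ('p::{finite,linorder} \<Rightarrow> 'a \<Rightarrow> 'a) \<Rightarrow>
   'n rvec \<Rightarrow> ('n, 'm::finite) rmat \<Rightarrow> ('n, 'n) rmat \<Rightarrow> ('n, 'p) rmat \<Rightarrow> ('p, 'n) rmat \<Rightarrow>
   real \<Rightarrow> ('a, 'm) vec \<Rightarrow> 'n \<Rightarrow> 'a"
where
  "xcomp A B d M N P R \<gamma> z i =
     resolvent (scale_op (\<gamma> / d $ i) (A i))
       ((1 / d $ i) *\<^sub>R (tensor_Id M z $ i)
        + (1 / d $ i) *\<^sub>R (\<Sum>j\<in>{j. j < i}. N $ i $ j *\<^sub>R xcomp A B d M N P R \<gamma> z j)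
        - (\<gamma> / d $ i) *\<^sub>R (\<Sum>j\<in>{j. idx j < idx i}. P $ i $ j *\<^sub>R
            B j (\<Sum>t\<in>{t. idx t \<le> idx j}. R $ j $ t *\<^sub>R xcomp A B d M N P R \<gamma> z t)))"
  by pat_completeness auto
termination
  by (relation "Wellfounded.measure (\<lambda>(A, B, d, M, N, P, R, \<gamma>, z, i). idx i)")
    (auto simp flip: idx_less_iff)

declare xcomp.simps [simp del]

definition xmap ::
  "('n::{finite,linorder} \<Rightarrow> 'a::real_inner \<Rightarrow> 'a set) \<Rightarrow> ('p::{finite,linorder} \<Rightarrow> 'a \<Rightarrow> 'a) \<Rightarrow>
   'n rvec \<Rightarrow> ('n, 'm::finite) rmat \<Rightarrow> ('n, 'n) rmat \<Rightarrow> ('n, 'p) rmat \<Rightarrow> ('p, 'n) rmat \<Rightarrow>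
   real \<Rightarrow> ('a, 'm) vec \<Rightarrow> ('a, 'n) vec"
where
  "xmap A B d M N P R \<gamma> z = (\<chi> i. xcomp A B d M N P R \<gamma> z i)"

definition Tmap ::
  "('n::{finite,linorder} \<Rightarrow> 'a::real_inner \<Rightarrow> 'a set) \<Rightarrow> ('p::{finite,linorder} \<Rightarrow> 'a \<Rightarrow> 'a) \<Rightarrow>
   'n rvec \<Rightarrow> ('n, 'm::finite) rmat \<Rightarrow> ('n, 'n) rmat \<Rightarrow> ('n, 'p) rmat \<Rightarrow> ('p, 'n) rmat \<Rightarrow>
   real \<Rightarrow> real \<Rightarrow> ('a, 'm) vec \<Rightarrow> ('a, 'm) vec"
where
  "Tmap A B d M N P R \<theta> \<gamma> z = z - \<theta> *\<^sub>R tensor_Id (transpose M) (xmap A B d M N P R \<gamma> z)"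

definition emap ::
  "('n::{finite,linorder} \<Rightarrow> 'a::real_inner \<Rightarrow> 'a set) \<Rightarrow> ('p::{finite,linorder} \<Rightarrow> 'a \<Rightarrow> 'a) \<Rightarrow>
   'n rvec \<Rightarrow> ('n, 'm::finite) rmat \<Rightarrow> ('n, 'n) rmat \<Rightarrow> ('n, 'p) rmat \<Rightarrow> ('p, 'n) rmat \<Rightarrow>
   real \<Rightarrow> ('a, 'm) vec \<Rightarrow> ('a, 'n) vec"
where
  "emap A B d M N P R \<gamma> z =
     orth_proj (range (tensor_Id M :: ('a, 'm) vec \<Rightarrow> ('a, 'n) vec))
       (\<chi> i. d $ i *\<^sub>R (xmap A B d M N P R \<gamma> z $ i)
             - (\<Sum>j\<in>{j. j < i}. N $ i $ j *\<^sub>R (xmap A B d M N P R \<gamma> z $ j)))"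

text \<open>\<open>Qmap A B d M N P R \<delta> \<gamma>\<close> relocates from step size \<open>\<gamma>\<close> to step size \<open>\<delta>\<close>.\<close>

definition Qmap ::
  "('n::{finite,linorder} \<Rightarrow> 'a::real_inner \<Rightarrow> 'a set) \<Rightarrow> ('p::{finite,linorder} \<Rightarrow> 'a \<Rightarrow> 'a) \<Rightarrow>
   'n rvec \<Rightarrow> ('n, 'm::finite) rmat \<Rightarrow> ('n, 'n) rmat \<Rightarrow> ('n, 'p) rmat \<Rightarrow> ('p, 'n) rmat \<Rightarrow>
   real \<Rightarrow> real \<Rightarrow> ('a, 'm) vec \<Rightarrow> ('a, 'm) vec"
where
  "Qmap A B d M N P R \<delta> \<gamma> z =
     (\<delta> / \<gamma>) *\<^sub>R z + (1 - \<delta> / \<gamma>) *\<^sub>R tensor_Id (pinv M) (emap A B d M N P R \<gamma> z)"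

end

theory Submission
  imports Defs
begin

text \<open>
  With \<open>C = D - N\<close>, the recursion for \<open>x = x\<^sup>\<gamma>(z)\<close> is equivalent to the inclusion
  \<open>M z \<in> C x + \<gamma> (A x + P B(R x))\<close>. Comparing \<open>x\<close> with a constant solution, the quadratic form of \<open>C\<close> is
  at least \<open>\<parallel>M\<^sup>* x\<parallel>\<^sup>2 / 2\<close>, and cocoercivity bounds the forward term below by \<open>- \<gamma> \<mu> \<parallel>M\<^sup>* x\<parallel>\<^sup>2 / 4\<close>, because
  \<open>P\<^sup>* - R\<close> vanishes on constant tuples and so factors through \<open>M\<^sup>*\<close>. Hence an admissible step never increases the
  distance to a fixed point and \<open>\<parallel>M\<^sup>* x\<parallel>\<^sup>2\<close> is controlled by the decrease.

  Relocation moves a fixed point affinely in the step size and has Lipschitz constant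
  \<open>1 + O(\<bar>\<delta> - \<gamma>\<bar>)\<close>. Since \<open>\<gamma>\<^sub>k\<close> converges, summability of the positive parts of its increments gives
  summability of all of them, so the distances to the relocated fixed points still converge and
  \<open>M\<^sup>* x\<^sub>k \<rightarrow> 0\<close>. Weak cluster points solve the limiting inclusion because the duality pairing of
  \<open>(x\<^sub>k, R x\<^sub>k)\<close> with the chosen elements of \<open>A x\<^sub>k\<close> and \<open>B(R x\<^sub>k)\<close> equals
  \<open>(\<langle>M\<^sup>* x\<^sub>k, z\<^sub>k\<rangle> - \<langle>x\<^sub>k, C x\<^sub>k\<rangle>) / \<gamma>\<^sub>k\<close> up to a term that \<open>M\<^sup>* x\<^sub>k\<close> controls, and this tends to \<open>0\<close>.
  Opial's argument then identifies all weak cluster points.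
\<close>

section \<open>Hilbert spaces\<close>

text \<open>The objective is \<open>r + (norm h)\<^sup>2 / 2\<close>. Its quadratic term makes a
  minimising sequence Cauchy in \<open>h\<close>, and the conclusion is the first-order optimality
  condition at the minimiser. It feeds both the Riesz and the Minty argument.\<close>

lemma quadratic_minimum_over_epigraph:
  fixes E :: "('h::{real_inner,complete_space} \<times> real) set"
  assumes ne: "E \<noteq> {}" and cl: "closed E" and cv: "convex E"
    and bdd: "\<And>h r. (h, r) \<in> E \<Longrightarrow> c \<le> r + (norm h)\<^sup>2 / 2"
  obtains h0 r0 where "(h0, r0) \<in> E"
    "\<And>h r. (h, r) \<in> E \<Longrightarrow> 0 \<le> h0 \<bullet> (h - h0) + (r - r0)"
proof -
  define g where "g p = snd p + (norm (fst p))\<^sup>2 / 2" for p :: "'h \<times> real"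
  define m where "m = Inf (g ` E)"
  have bb: "bdd_below (g ` E)"
    using bdd by (intro bdd_belowI[of _ c]) (auto simp: g_def)
  have m_le: "m \<le> g p" if "p \<in> E" for p
    unfolding m_def using that bb by (intro cInf_lower) auto
  have "\<exists>p\<in>E. g p < m + 1 / real (Suc n)" for n
  proof -
    have "Inf (g ` E) < m + 1 / real (Suc n)"
      unfolding m_def by simp
    then show ?thesis
      using cInf_less_iff[of "g ` E"] ne bb by auto
  qed
  then obtain p where pE: "\<And>n. p n \<in> E" and pm: "\<And>n. g (p n) < m + 1 / real (Suc n)"
    by metis
  define h where "h = (\<lambda>n. fst (p n))"
  define r where "r = (\<lambda>n. snd (p n))"
  \<comment> \<open>The midpoint of two near-minimisers lies in \<open>E\<close>, so its value is at
    least \<open>m\<close>; the parallelogram identity then bounds their distance.\<close>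
  have par: "(norm (h n - h k))\<^sup>2 \<le> 4 * (1 / real (Suc n) + 1 / real (Suc k))" for n k
  proof -
    have "(1/2) *\<^sub>R p n + (1/2) *\<^sub>R p k \<in> E"
      using cv pE unfolding convex_def by (metis field_sum_of_halves half_gt_zero less_eq_real_def zero_less_one)
    then have "m \<le> g ((1/2) *\<^sub>R p n + (1/2) *\<^sub>R p k)"
      by (rule m_le)
    also have "\<dots> = g (p n) / 2 + g (p k) / 2 - (norm (h n - h k))\<^sup>2 / 8"
      unfolding g_def h_def power2_norm_eq_inner
      by (simp add: inner_simps inner_commute field_simps)
    finally show ?thesis
      using pm[of n] pm[of k] by simp
  qed
  have inv0: "(\<lambda>n. 1 / real (Suc n)) \<longlonglongrightarrow> 0"
    using LIMSEQ_Suc[OF lim_1_over_n] by simp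
  have "Cauchy h"
  proof (rule metric_CauchyI)
    fix e :: real assume "0 < e"
    then have "\<forall>\<^sub>F n in sequentially. 1 / real (Suc n) < e\<^sup>2 / 8"
      using order_tendstoD(2)[OF inv0, of "e\<^sup>2/8"] by simp
    then obtain K where K: "\<And>n. n \<ge> K \<Longrightarrow> 1 / real (Suc n) < e\<^sup>2 / 8"
      by (auto simp: eventually_sequentially)
    have "dist (h n) (h k) < e" if "n \<ge> K" "k \<ge> K" for n k
    proof -
      have "(norm (h n - h k))\<^sup>2 < e\<^sup>2"
      proof (rule order.strict_trans1[OF par])
        have "4 * (1 / real (Suc n) + 1 / real (Suc k)) < 4 * (e\<^sup>2 / 8 + e\<^sup>2 / 8)"
          by (intro mult_strict_left_mono add_strict_mono K that) simp
        then show "4 * (1 / real (Suc n) + 1 / real (Suc k)) < e\<^sup>2"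
          by simp
      qed
      then show ?thesis
        using \<open>0 < e\<close> by (simp add: dist_norm power2_less_imp_less)
    qed
    then show "\<exists>K. \<forall>n\<ge>K. \<forall>k\<ge>K. dist (h n) (h k) < e"
      by blast
  qed
  then obtain h0 where h0: "h \<longlonglongrightarrow> h0"
    using Cauchy_convergent_iff convergent_def by blast
  have gm: "(\<lambda>n. g (p n)) \<longlonglongrightarrow> m"
  proof (rule tendsto_sandwich)
    show "\<forall>\<^sub>F n in sequentially. m \<le> g (p n)"
      using m_le pE by simp
    show "\<forall>\<^sub>F n in sequentially. g (p n) \<le> m + 1 / real (Suc n)"
      using pm less_imp_le by (intro always_eventually allI) blast
    show "(\<lambda>n. m + 1 / real (Suc n)) \<longlonglongrightarrow> m"
      using tendsto_add[OF tendsto_const inv0, of m] by simp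
  qed simp
  \<comment> \<open>This value makes the objective at \<open>(h0, r0)\<close> equal to the infimum
    \<open>m\<close>.\<close>
  define r0 where "r0 = m - (norm h0)\<^sup>2 / 2"
  have "(\<lambda>n. g (p n) - (norm (h n))\<^sup>2 / 2) \<longlonglongrightarrow> r0"
    unfolding r0_def by (intro tendsto_intros gm h0) simp
  then have "r \<longlonglongrightarrow> r0"
    by (simp add: g_def h_def r_def)
  then have "(\<lambda>n. (h n, r n)) \<longlonglongrightarrow> (h0, r0)"
    by (intro tendsto_Pair h0)
  then have "p \<longlonglongrightarrow> (h0, r0)"
    by (simp add: h_def r_def)
  then have E0: "(h0, r0) \<in> E"
    using cl pE closed_sequentially by blast
  have var: "0 \<le> h0 \<bullet> (h' - h0) + (r' - r0)" if "(h', r') \<in> E" for h' r'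
  proof (rule ccontr)
    define s where "s = h0 \<bullet> (h' - h0) + (r' - r0)"
    define q where "q = (norm (h' - h0))\<^sup>2"
    assume "\<not> ?thesis"
    then have s: "s < 0" by (simp add: s_def)
    have q: "q \<ge> 0" by (simp add: q_def)
    \<comment> \<open>Moving by \<open>t\<close> towards \<open>(h', r')\<close> changes the
      objective by \<open>t * (s + t * q / 2)\<close>. The bound
      \<open>t * (q + 1) \<le> - s\<close> makes the bracket at most \<open>(s - t) / 2\<close>,
      which is negative.\<close>
    define t where "t = min 1 (- s / (q + 1))"
    have t: "0 < t" "t \<le> 1" "t \<le> - s / (q + 1)"
      using s q by (auto simp: t_def divide_neg_pos)
    have "(1 - t) *\<^sub>R (h0, r0) + t *\<^sub>R (h', r') \<in> E"
      using cv E0 that t unfolding convex_alt by (meson less_imp_le)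
    then have "m \<le> g ((1 - t) *\<^sub>R (h0, r0) + t *\<^sub>R (h', r'))"
      by (rule m_le)
    also have "\<dots> = m + t * s + t\<^sup>2 * q / 2"
      unfolding g_def s_def q_def r0_def power2_norm_eq_inner
      by (simp add: inner_simps inner_commute field_simps power2_eq_square)
    finally have "0 \<le> t * (s + t * q / 2)"
      by (simp add: algebra_simps power2_eq_square)
    then have "0 \<le> s + t * q / 2"
      using t(1) by (simp add: zero_le_mult_iff)
    moreover have "t * (q + 1) \<le> - s"
      using t(3) q by (simp add: field_simps)
    ultimately have "0 \<le> s - s / 2 - t / 2"
      by (simp add: algebra_simps)
    with s t(1) show False by simp
  qed
  show ?thesis
    using that E0 var by blast
qed

text \<open>The representer minimises \<open>(norm h)\<^sup>2 / 2 - f h\<close>, the objective on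
  the graph of \<open>- f\<close>. As that graph is linear, the optimality inequality holds for
  \<open>h\<close> and \<open>- h\<close> alike, hence with equality.\<close>

lemma riesz_representation:
  fixes f :: "'h::{real_inner,complete_space} \<Rightarrow> real"
  assumes "bounded_linear f"
  obtains u where "\<And>h. f h = u \<bullet> h"
proof -
  interpret bounded_linear f by fact
  obtain K where K: "\<And>h. norm (f h) \<le> norm h * K"
    using bounded by blast
  define E where "E = range (\<lambda>h. (h, - f h))"
  have ne: "E \<noteq> {}"
    by (simp add: E_def)
  have cl: "closed E"
  proof -
    have "E = {p. snd p = - f (fst p)}"
      by (auto simp: E_def image_def prod_eq_iff)
    moreover have "closed {p :: 'h \<times> real. snd p = - f (fst p)}"
      by (intro closed_Collect_eq continuous_intros continuous_on)
    ultimately show ?thesis by simp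
  qed
  have cv: "convex E"
    by (force simp: E_def convex_def add scaleR)
  have bdd: "- (K\<^sup>2 / 2) \<le> r + (norm h)\<^sup>2 / 2" if "(h, r) \<in> E" for h r
  proof -
    have "f h \<le> norm h * K"
      using K[of h] by auto
    moreover have "0 \<le> (norm h - K)\<^sup>2"
      by simp
    ultimately show ?thesis
      using that by (simp add: E_def image_iff power2_eq_square algebra_simps)
  qed
  obtain u r0 where u: "(u, r0) \<in> E" "\<And>h r. (h, r) \<in> E \<Longrightarrow> 0 \<le> u \<bullet> (h - u) + (r - r0)"
    by (rule quadratic_minimum_over_epigraph[OF ne cl cv bdd]) blast+
  have ge: "0 \<le> u \<bullet> h - f h" for h
  proof -
    have "(u + h, - f (u + h)) \<in> E"
      unfolding E_def by blast
    moreover have "r0 = - f u"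
      using u(1) by (auto simp: E_def)
    ultimately show ?thesis
      using u(2)[of "u + h" "- f (u + h)"] by (simp add: add)
  qed
  have "f h = u \<bullet> h" for h
    using ge[of h] ge[of "- h"] by (simp add: linear_neg linear_axioms)
  with that show ?thesis by blast
qed

text \<open>The set \<open>E\<close> below is the epigraph of the Fitzpatrick function of \<open>G\<close>.\<close>

lemma minty:
  fixes G :: "('h::{real_inner,complete_space} \<times> 'h) set"
  assumes mono: "\<And>x u y v. (x, u) \<in> G \<Longrightarrow> (y, v) \<in> G \<Longrightarrow> 0 \<le> (x - y) \<bullet> (u - v)"
    and maxi: "\<And>x u. (\<And>y v. (y, v) \<in> G \<Longrightarrow> 0 \<le> (x - y) \<bullet> (u - v)) \<Longrightarrow> (x, u) \<in> G"
  obtains x where "(x, - x) \<in> G"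
proof -
  define E :: "(('h \<times> 'h) \<times> real) set"
    where "E = {p. \<forall>(y, v)\<in>G. fst (fst p) \<bullet> v + y \<bullet> snd (fst p) - y \<bullet> v \<le> snd p}"
  have inE: "((y, v), y \<bullet> v) \<in> E" if "(y, v) \<in> G" for y v
    using mono[OF that] by (force simp: E_def inner_simps inner_commute)
  have "G \<noteq> {}"
    using maxi[of 0 0] by auto
  then have ne: "E \<noteq> {}"
    using inE by force
  have "E = (\<Inter>g\<in>G. {p. fst (fst p) \<bullet> snd g + fst g \<bullet> snd (fst p) - fst g \<bullet> snd g \<le> snd p})"
    by (auto simp: E_def split_beta)
  moreover have "closed \<dots>"
    by (intro closed_INT ballI closed_Collect_le continuous_intros)
  ultimately have cl: "closed E" by simp
  have cv: "convex E"
    unfolding convex_alt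
  proof clarify
    fix a b c a' b' c' and t :: real
    assume *: "((a, b), c) \<in> E" "((a', b'), c') \<in> E" and t: "0 \<le> t" "t \<le> 1"
    have "(1 - t) * (a \<bullet> v + y \<bullet> b - y \<bullet> v) + t * (a' \<bullet> v + y \<bullet> b' - y \<bullet> v) \<le> (1 - t) * c + t * c'"
      if "(y, v) \<in> G" for y v
      using * that t by (intro add_mono mult_left_mono) (auto simp: E_def)
    then show "(1 - t) *\<^sub>R ((a, b), c) + t *\<^sub>R ((a', b'), c') \<in> E"
      by (force simp: E_def inner_simps algebra_simps)
  qed
  \<comment> \<open>If \<open>r < x \<bullet> u\<close>, the constraints defining \<open>E\<close>
    make \<open>(x, u)\<close> monotonically related to \<open>G\<close>, hence a member of
    \<open>G\<close>; the constraint at that very point then gives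
    \<open>x \<bullet> u \<le> r\<close>.\<close>
  have fitz: "x \<bullet> u \<le> r" if "((x, u), r) \<in> E" for x u r
  proof (rule ccontr)
    assume r: "\<not> ?thesis"
    have le: "x \<bullet> v + y \<bullet> u - y \<bullet> v \<le> r" if "(y, v) \<in> G" for y v
      using \<open>((x, u), r) \<in> E\<close> that by (auto simp: E_def)
    have "(x, u) \<in> G"
    proof (rule maxi)
      fix y v assume "(y, v) \<in> G"
      from le[OF this] r show "0 \<le> (x - y) \<bullet> (u - v)"
        by (simp add: inner_simps inner_commute)
    qed
    with le r show False by force
  qed
  have bdd: "0 \<le> r + (norm p)\<^sup>2 / 2" if "(p, r) \<in> E" for p r
  proof (cases p)
    case (Pair x u)
    have "0 \<le> (norm (x + u))\<^sup>2" by simp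
    then have "0 \<le> (norm x)\<^sup>2 + (norm u)\<^sup>2 + 2 * (x \<bullet> u)"
      by (simp add: power2_norm_eq_inner inner_simps inner_commute)
    moreover have "x \<bullet> u \<le> r"
      using fitz that Pair by simp
    moreover have "(norm p)\<^sup>2 = (norm x)\<^sup>2 + (norm u)\<^sup>2"
      by (simp add: Pair norm_Pair)
    ultimately show ?thesis
      by linarith
  qed
  obtain p0 r0 where p0: "(p0, r0) \<in> E"
      "\<And>p r. (p, r) \<in> E \<Longrightarrow> 0 \<le> p0 \<bullet> (p - p0) + (r - r0)"
    by (rule quadratic_minimum_over_epigraph[OF ne cl cv bdd]) blast+
  obtain x u where xu: "p0 = (x, u)" by (cases p0)
  have r0: "x \<bullet> u \<le> r0"
    using fitz p0(1) xu by simp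
  \<comment> \<open>Optimality is tested at the point \<open>((y, v), y \<bullet> v)\<close> of
    \<open>E\<close>. It shows that \<open>(- u, - x)\<close> is monotonically related to
    \<open>G\<close>; inserting that point itself leaves \<open>x + u = 0\<close>.\<close>
  have key: "(norm (x + u))\<^sup>2 \<le> (- u - y) \<bullet> (- x - v)" if "(y, v) \<in> G" for y v
    using p0(2)[OF inE[OF that]] r0
    by (simp add: xu inner_simps power2_norm_eq_inner inner_commute)
  have "(- u, - x) \<in> G"
    by (rule maxi) (meson key order_trans zero_le_power2)
  from key[OF this] have "x + u = 0"
    by simp
  then have "- u = x"
    by (simp add: neg_eq_iff_add_eq_0 add.commute)
  with \<open>(- u, - x) \<in> G\<close> that show ?thesis
    by auto
qed

section \<open>Maximally monotone operators and their resolvents\<close>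

lemma maximally_monotoneD:
  assumes "maximally_monotone A" "u \<in> A x" "v \<in> A y"
  shows "0 \<le> (x - y) \<bullet> (u - v)"
  using assms by (auto simp: maximally_monotone_def monotone_op_def)

text \<open>Adjoining the monotonically related pair \<open>(x, u)\<close> keeps the operator
  monotone, so maximality forces the pair to be in the graph already.\<close>

lemma maximally_monotone_memI:
  fixes A :: "'a::real_inner \<Rightarrow> 'a set"
  assumes A: "maximally_monotone A"
    and *: "\<And>y v. v \<in> A y \<Longrightarrow> 0 \<le> (x - y) \<bullet> (u - v)"
  shows "u \<in> A x"
proof -
  define A' where "A' y = (if y = x then insert u (A x) else A y)" for y
  have swapped: "0 \<le> (y - x) \<bullet> (v - u)" if "v \<in> A y" for y v
    using *[OF that] by (metis inner_minus_left inner_minus_right minus_diff_eq minus_minus)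
  have "monotone_op A'"
    unfolding monotone_op_def
  proof (intro allI ballI)
    fix y y' v v' assume "v \<in> A' y" "v' \<in> A' y'"
    then have "v \<in> A y \<or> (y = x \<and> v = u)" "v' \<in> A y' \<or> (y' = x \<and> v' = u)"
      by (auto simp: A'_def split: if_splits)
    then show "0 \<le> (y - y') \<bullet> (v - v')"
      using maximally_monotoneD[OF A, of v y v' y'] * swapped by auto
  qed
  moreover have "\<forall>y. A y \<subseteq> A' y"
    by (auto simp: A'_def)
  ultimately have "A' = A"
    using A unfolding maximally_monotone_def by blast
  then show ?thesis
    by (metis A'_def insertI1)
qed

text \<open>Minty's theorem supplies a solution and monotonicity makes it unique, so the definite
  description in \<open>resolvent\<close> can be traded for an inclusion.\<close>

lemma resolvent_eq_iff:
  fixes A :: "'a::{real_inner,complete_space} \<Rightarrow> 'a set"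
  assumes A: "maximally_monotone A" and c: "0 < c"
  shows "resolvent (scale_op c A) y = x \<longleftrightarrow> (\<exists>a\<in>A x. x + c *\<^sub>R a = y)"
proof -
  have set: "y \<in> {x} + scale_op c A x \<longleftrightarrow> (\<exists>a\<in>A x. x + c *\<^sub>R a = y)" for x
    by (auto simp: set_plus_def scale_op_def)
  have uniq: "x = x'" if "a \<in> A x" "x + c *\<^sub>R a = y" "a' \<in> A x'" "x' + c *\<^sub>R a' = y" for x x' a a'
  proof -
    have "x - x' = - (c *\<^sub>R (a - a'))"
      using that(2,4) by (auto simp: algebra_simps)
    then have "(x - x') \<bullet> (x - x') = - c * ((x - x') \<bullet> (a - a'))"
      by (metis inner_minus_right inner_scaleR_right mult_minus_left)
    also have "\<dots> \<le> 0"
      using maximally_monotoneD[OF A that(1,3)] c by simp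
    finally show ?thesis
      by (metis eq_iff_diff_eq_0 inner_eq_zero_iff inner_ge_zero order_antisym)
  qed
  \<comment> \<open>The graph of \<open>c A\<close> shifted by \<open>- y\<close>: a point
    \<open>(x, - x)\<close> in it is a solution of \<open>x + c a = y\<close>.\<close>
  define G where "G = {(x, c *\<^sub>R a - y) |x a. a \<in> A x}"
  have mono: "0 \<le> (x - x') \<bullet> (u - u')" if xu: "(x, u) \<in> G" "(x', u') \<in> G" for x u x' u'
  proof -
    obtain a a' where "u = c *\<^sub>R a - y" "a \<in> A x" "u' = c *\<^sub>R a' - y" "a' \<in> A x'"
      using xu by (auto simp: G_def)
    then have "u - u' = c *\<^sub>R (a - a')" "0 \<le> (x - x') \<bullet> (a - a')"
      using maximally_monotoneD[OF A] by (auto simp: scaleR_diff_right)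
    with c show ?thesis by simp
  qed
  have maxi: "(x, u) \<in> G" if "\<And>x' u'. (x', u') \<in> G \<Longrightarrow> 0 \<le> (x - x') \<bullet> (u - u')" for x u
  proof -
    have "(1 / c) *\<^sub>R (u + y) \<in> A x"
    proof (rule maximally_monotone_memI[OF A])
      fix x' a assume a: "a \<in> A x'"
      have "0 \<le> (x - x') \<bullet> (u - (c *\<^sub>R a - y))"
        using that a by (auto simp: G_def)
      also have "u - (c *\<^sub>R a - y) = c *\<^sub>R ((1 / c) *\<^sub>R (u + y) - a)"
        using c by (simp add: algebra_simps)
      finally show "0 \<le> (x - x') \<bullet> ((1 / c) *\<^sub>R (u + y) - a)"
        using c by (simp add: zero_le_mult_iff)
    qed
    moreover have "u = c *\<^sub>R ((1 / c) *\<^sub>R (u + y)) - y"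
      using c by simp
    ultimately show ?thesis
      unfolding G_def by blast
  qed
  obtain x1 where "(x1, - x1) \<in> G"
    using minty[OF mono maxi] by blast
  then obtain a1 where a1: "a1 \<in> A x1" "x1 + c *\<^sub>R a1 = y"
    by (auto simp: G_def algebra_simps)
  have "resolvent (scale_op c A) y = x1"
    unfolding resolvent_def set using a1 uniq by (intro the_equality) blast+
  then show ?thesis
    using a1 uniq[OF a1] by metis
qed

text \<open>Weak limits are taken along arbitrary filters, so that a weak cluster point of a sequence is
  the weak limit along a finer filter; no subsequences of non-separable spaces are needed.\<close>

definition weak_lim :: "('i \<Rightarrow> 'h::real_inner) \<Rightarrow> 'h \<Rightarrow> 'i filter \<Rightarrow> bool" where
  "weak_lim x l F \<longleftrightarrow> (\<forall>y. ((\<lambda>k. x k \<bullet> y) \<longlongrightarrow> l \<bullet> y) F)"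

lemma weak_limD: "weak_lim x l F \<Longrightarrow> ((\<lambda>k. x k \<bullet> y) \<longlongrightarrow> l \<bullet> y) F"
  by (simp add: weak_lim_def)

lemma weak_lim_mono: "weak_lim x l F \<Longrightarrow> G \<le> F \<Longrightarrow> weak_lim x l G"
  using tendsto_mono by (fastforce simp: weak_lim_def)

lemma weak_lim_unique:
  assumes "F \<noteq> bot" "weak_lim x l F" "weak_lim x l' F"
  shows "l = l'"
proof -
  have "l \<bullet> (l - l') = l' \<bullet> (l - l')"
    using tendsto_unique[OF assms(1)] weak_limD[OF assms(2)] weak_limD[OF assms(3)] by blast
  then have "(l - l') \<bullet> (l - l') = 0"
    by (simp add: inner_diff_left)
  then show ?thesis by simp
qed

text \<open>The Banach-Alaoglu argument: by Tychonoff the functionals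
  \<open>\<lambda>y. x k \<bullet> y\<close> lie in a compact box of functions, a cluster point of
  them is again bounded and linear, and Riesz turns it into a vector.\<close>

lemma bounded_imp_weak_cluster:
  fixes x :: "'i \<Rightarrow> 'h::{real_inner,complete_space}"
  assumes F: "F \<noteq> bot" and C: "\<And>k. norm (x k) \<le> C"
  obtains G l where "G \<le> F" "G \<noteq> bot" "weak_lim x l G"
proof -
  define \<phi> where "\<phi> k = (\<lambda>y. x k \<bullet> y)" for k
  define S where "S = PiE UNIV (\<lambda>y::'h. {- (C * norm y)..C * norm y})"
  have "compactin (product_topology (\<lambda>_. euclidean) UNIV) S"
    unfolding S_def compactin_PiE by simp
  then have "compact S"
    by (simp add: euclidean_product_topology flip: compactin_euclidean_iff)
  have "\<phi> k \<in> S" for k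
  proof -
    have "\<bar>x k \<bullet> y\<bar> \<le> C * norm y" for y
      by (rule order_trans[OF Cauchy_Schwarz_ineq2]) (intro mult_right_mono C norm_ge_zero)
    then show ?thesis
      by (auto simp: S_def \<phi>_def abs_le_iff minus_le_iff)
  qed
  then have "\<forall>\<^sub>F f in filtermap \<phi> F. f \<in> S"
    by (simp add: eventually_filtermap)
  moreover have "filtermap \<phi> F \<noteq> bot"
    using F by (simp add: filtermap_bot_iff)
  ultimately obtain f where f: "f \<in> S" "inf (nhds f) (filtermap \<phi> F) \<noteq> bot"
    using \<open>compact S\<close> unfolding compact_filter by blast
  \<comment> \<open>Refining \<open>F\<close> by preimages of neighbourhoods of \<open>f\<close>
    makes \<open>\<phi>\<close> converge to \<open>f\<close>; the filter stays proper because
    \<open>f\<close> is a cluster point.\<close>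
  define G where "G = inf (filtercomap \<phi> (nhds f)) F"
  have G: "G \<noteq> bot"
  proof
    assume "G = bot"
    then have "eventually (\<lambda>_. False) G" by simp
    then obtain Q U where QU: "eventually Q (nhds f)" "eventually U F" "\<And>k. Q (\<phi> k) \<Longrightarrow> U k \<Longrightarrow> False"
      unfolding G_def eventually_inf eventually_filtercomap by blast
    have "eventually (\<lambda>g. \<not> Q g) (filtermap \<phi> F)"
      using QU(2) by (auto simp: eventually_filtermap elim!: eventually_mono dest: QU(3))
    then have "eventually (\<lambda>_. False) (inf (nhds f) (filtermap \<phi> F))"
      unfolding eventually_inf using QU(1) by blast
    with f(2) show False
      by (simp add: trivial_limit_def)
  qed
  have "(\<phi> \<longlongrightarrow> f) G"
    unfolding filterlim_iff_le_filtercomap G_def by simp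
  moreover have "((\<lambda>g. g y) \<longlongrightarrow> f y) (at f)" for y :: 'h
  proof -
    have "continuous_on UNIV (\<lambda>g :: 'h \<Rightarrow> real. g y)"
      by (rule continuous_on_product_coordinates)
    then show ?thesis
      by (simp add: continuous_on_def)
  qed
  ultimately have lim: "((\<lambda>k. x k \<bullet> y) \<longlongrightarrow> f y) G" for y
    using tendsto_compose[where g = "\<lambda>g. g y" and l = f and f = \<phi> and F = G] by (simp add: \<phi>_def)
  have "bounded_linear f"
  proof (rule bounded_linear_intro)
    fix y y' and s :: real
    show "f (y + y') = f y + f y'"
      using tendsto_unique[OF G lim[of "y + y'"]] tendsto_add[OF lim lim] by (simp add: inner_add_right)
    show "f (s *\<^sub>R y) = s *\<^sub>R f y"
      using tendsto_unique[OF G lim[of "s *\<^sub>R y"]] tendsto_mult_left[OF lim] by simp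
    show "norm (f y) \<le> norm y * C"
    proof -
      have "f y \<in> {- (C * norm y)..C * norm y}"
        using f(1) unfolding S_def by (rule PiE_mem) simp
      then show ?thesis by (auto simp: mult.commute abs_le_iff)
    qed
  qed
  then obtain l where "\<And>h. f h = l \<bullet> h"
    using riesz_representation by blast
  then have "weak_lim x l G"
    using lim by (simp add: weak_lim_def)
  moreover have "G \<le> F"
    by (simp add: G_def)
  ultimately show ?thesis
    using that G by blast
qed

text \<open>The subsequence principle for filters: were convergence to fail, the points at distance
  at least \<open>e\<close> from \<open>l\<close> would cut out a proper subfilter none of whose
  proper refinements sends \<open>f\<close> to \<open>l\<close>.\<close>

lemma tendsto_if_subfilters:
  fixes f :: "'i \<Rightarrow> 'b::metric_space"
  assumes "\<And>G. G \<le> F \<Longrightarrow> G \<noteq> bot \<Longrightarrow> \<exists>H\<le>G. H \<noteq> bot \<and> (f \<longlongrightarrow> l) H"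
  shows "(f \<longlongrightarrow> l) F"
proof (rule tendstoI, rule ccontr)
  fix e :: real assume e: "0 < e" and not: "\<not> (\<forall>\<^sub>F k in F. dist (f k) l < e)"
  define G where "G = inf F (principal {k. \<not> dist (f k) l < e})"
  have "G \<noteq> bot"
    using not by (auto simp: G_def trivial_limit_def eventually_inf_principal)
  then obtain H where H: "H \<le> G" "H \<noteq> bot" "(f \<longlongrightarrow> l) H"
    using assms[of G] by (auto simp: G_def)
  have "\<forall>\<^sub>F k in H. \<not> dist (f k) l < e"
    using H(1) by (rule filter_leD) (simp add: G_def eventually_inf_principal)
  moreover have "\<forall>\<^sub>F k in H. dist (f k) l < e"
    using H(3) e by (rule tendstoD)
  ultimately have "\<forall>\<^sub>F k in H. False"
    by eventually_elim simp
  with H(2) show False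
    by (simp add: trivial_limit_def)
qed

lemma weak_strong_inner:
  assumes "(u \<longlongrightarrow> 0) F" and "\<And>k. norm (v k) \<le> C"
  shows "((\<lambda>k. u k \<bullet> v k) \<longlongrightarrow> 0) F"
proof (rule Lim_null_comparison)
  show "((\<lambda>k. norm (u k) * C) \<longlongrightarrow> 0) F"
    using assms(1) by (intro tendsto_mult_left_zero tendsto_norm_zero)
  show "\<forall>\<^sub>F k in F. norm (u k \<bullet> v k) \<le> norm (u k) * C"
    by (intro always_eventually allI)
      (metis Cauchy_Schwarz_ineq2 assms(2) mult_left_mono norm_ge_zero order_trans real_norm_def)
qed

section \<open>The Moore--Penrose inverse\<close>

lemma matrix_diff_ldistrib:
  fixes K :: "real ^ 'm ^ 'n"
  shows "K ** (L - L') = K ** L - K ** L'"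
  by (simp add: vec_eq_iff matrix_matrix_mult_def right_diff_distrib sum_subtractf)

lemma matrix_diff_rdistrib:
  fixes K :: "real ^ 'm ^ 'n"
  shows "(K - K') ** L = K ** L - K' ** L"
  by (simp add: vec_eq_iff matrix_matrix_mult_def left_diff_distrib sum_subtractf)

lemma transpose_matrix_diff:
  fixes K :: "real ^ 'm ^ 'n"
  shows "transpose (K - L) = transpose K - transpose L"
  by (simp add: vec_eq_iff transpose_def)

lemma inner_matrix_vector_adjoint:
  fixes K :: "real ^ 'm ^ 'n"
  shows "(K *v v) \<bullet> w = v \<bullet> (transpose K *v w)"
  by (metis dot_lmul_matrix inner_commute transpose_matrix_vector)

lemma matrix_inner_inverse_exists:
  fixes K :: "real ^ 'm ^ 'n"
  obtains G where "K ** G ** K = K"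
proof -
  have "Vector_Spaces.linear (*s) (*s) ((*v) K)"
    by (rule matrix_vector_mul_linear_gen)
  then obtain g where g: "Vector_Spaces.linear (*s) (*s) g" "\<And>v. K *v (g (K *v v)) = K *v v"
    using vec.linear_exists_right_inverse_on[of "(*v) K" UNIV] vec.subspace_UNIV by auto
  have "K ** matrix g ** K = K"
    unfolding matrix_eq using g by (simp add: matrix_works flip: matrix_vector_mul_assoc)
  with that show ?thesis .
qed

text \<open>For every \<open>v\<close>, the squared norm of \<open>K *v (L *v v)\<close> is the
  pairing of \<open>L *v v\<close> with \<open>(transpose K ** K ** L) *v v\<close>.\<close>

lemma gram_matrix_cancel:
  fixes K :: "real ^ 'm ^ 'n" and L :: "real ^ 'l ^ 'm"
  assumes "transpose K ** K ** L = 0"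
  shows "K ** L = 0"
proof -
  have "(K ** L) *v v = 0" for v
  proof -
    have "(K *v (L *v v)) \<bullet> (K *v (L *v v)) = (L *v v) \<bullet> ((transpose K ** K ** L) *v v)"
      by (simp add: inner_matrix_vector_adjoint flip: matrix_vector_mul_assoc)
    also have "\<dots> = 0"
      using assms by simp
    finally show ?thesis
      by (simp add: matrix_vector_mul_assoc)
  qed
  then show ?thesis
    by (simp add: matrix_eq)
qed

text \<open>With \<open>Y\<close> an inner inverse of the Gram matrix of \<open>K\<close>, the
  choice is \<open>X = Y ** transpose K\<close>. Cancelling one factor \<open>transpose K\<close>
  gives the first identity; symmetry follows from it and its transpose.\<close>

lemma matrix_symmetric_inner_inverse_exists:
  fixes K :: "real ^ 'm ^ 'n"
  obtains X where "K ** X ** K = K" "transpose (K ** X) = K ** X"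
proof -
  obtain Y where Y: "(transpose K ** K) ** Y ** (transpose K ** K) = transpose K ** K"
    using matrix_inner_inverse_exists by blast
  define X where "X = Y ** transpose K"
  have "transpose K ** K ** (X ** K - mat 1) = 0"
    using Y by (simp add: X_def matrix_diff_ldistrib matrix_mul_assoc)
  then have "K ** (X ** K - mat 1) = 0"
    by (rule gram_matrix_cancel)
  then have 1: "K ** X ** K = K"
    by (simp add: matrix_diff_ldistrib matrix_mul_assoc)
  then have 2: "transpose K ** transpose (K ** X) = transpose K"
    by (metis matrix_transpose_mul)
  have "transpose (K ** X) = K ** X ** K ** transpose (Y) ** transpose K"
    using 1 by (simp add: X_def matrix_transpose_mul matrix_mul_assoc)
  also have "\<dots> = K ** Y ** (transpose K ** transpose (K ** X))"
    by (simp add: X_def matrix_transpose_mul matrix_mul_assoc)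
  also have "\<dots> = K ** X"
    unfolding 2 by (simp add: X_def matrix_mul_assoc)
  finally show ?thesis
    using that 1 by blast
qed

text \<open>The Penrose equations have exactly one solution, so the definite description in
  \<open>pinv\<close> denotes it.\<close>

lemma
  fixes K :: "real ^ 'm ^ 'n"
  shows pinv_inner: "K ** pinv K ** K = K"
    and pinv_symmetric: "transpose (K ** pinv K) = K ** pinv K"
proof -
  let ?pen = "\<lambda>G. K ** G ** K = K \<and> G ** K ** G = G
     \<and> transpose (K ** G) = K ** G \<and> transpose (G ** K) = G ** K"
  obtain X where X: "K ** X ** K = K" "transpose (K ** X) = K ** X"
    using matrix_symmetric_inner_inverse_exists by blast
  obtain Z' where "transpose K ** Z' ** transpose K = transpose K"
      "transpose (transpose K ** Z') = transpose K ** Z'"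
    using matrix_symmetric_inner_inverse_exists by blast
  moreover define Z where "Z = transpose Z'"
  ultimately have Z: "K ** Z ** K = K" "transpose (Z ** K) = Z ** K"
    by (metis matrix_mul_assoc matrix_transpose_mul transpose_transpose)+
  \<comment> \<open>Both \<open>X\<close> and \<open>Z\<close> are inner inverses, but only
    \<open>K ** X\<close> and \<open>Z ** K\<close> are known to be symmetric. Since
    \<open>K ** G = K ** X\<close> and \<open>G ** K = Z ** K\<close>, the product inherits both
    symmetries.\<close>
  define G where "G = Z ** K ** X"
  have KG: "K ** G = K ** X" and GK: "G ** K = Z ** K"
    using X(1) Z(1) by (simp_all add: G_def matrix_mul_assoc) (metis matrix_mul_assoc)
  have "G ** K ** G = Z ** (K ** X ** K) ** X"
    unfolding GK by (simp add: G_def matrix_mul_assoc) (metis X(1) Z(1) matrix_mul_assoc)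
  then have "?pen G"
    using X Z KG GK by (simp add: G_def)
  moreover have "G1 = G2" if pen: "?pen G1" "?pen G2" for G1 G2
  proof -
    have a: "K ** G1 = K ** G2"
    proof -
      have "K ** G1 = transpose (K ** G1)" using pen by simp
      also have "\<dots> = transpose (K ** G2 ** K ** G1)" using pen by simp
      also have "\<dots> = transpose (K ** G1) ** transpose (K ** G2)"
        by (simp add: matrix_transpose_mul matrix_mul_assoc)
      also have "\<dots> = (K ** G1 ** K) ** G2" using pen by (simp add: matrix_mul_assoc)
      also have "\<dots> = K ** G2" using pen by simp
      finally show ?thesis .
    qed
    have b: "G1 ** K = G2 ** K"
    proof -
      have "G1 ** K = transpose (G1 ** K)" using pen by simp
      also have "\<dots> = transpose (G1 ** (K ** G2 ** K))" using pen by simp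
      also have "\<dots> = transpose (G2 ** K) ** transpose (G1 ** K)"
        by (simp add: matrix_transpose_mul matrix_mul_assoc)
      also have "\<dots> = G2 ** (K ** G1 ** K)" using pen by (metis matrix_mul_assoc)
      also have "\<dots> = G2 ** K" using pen by metis
      finally show ?thesis .
    qed
    have "G1 = G1 ** K ** G1" using pen by simp
    also have "\<dots> = G1 ** (K ** G2)" using a by (simp flip: matrix_mul_assoc)
    also have "\<dots> = G2 ** K ** G2" using b by (simp add: matrix_mul_assoc)
    also have "\<dots> = G2" using pen by simp
    finally show ?thesis .
  qed
  ultimately have "?pen (pinv K)"
    unfolding pinv_def by (intro theI[of ?pen]) blast+
  then show "K ** pinv K ** K = K" "transpose (K ** pinv K) = K ** pinv K"
    by blast+
qed

section \<open>Matrices acting on tuples\<close>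

lemma tensor_Id_nth: "tensor_Id K z $ i = (\<Sum>j\<in>UNIV. K $ i $ j *\<^sub>R z $ j)"
  by (simp add: tensor_Id_def)

lemma linear_tensor_Id: "linear (tensor_Id K)"
  by (rule linearI)
    (simp_all add: vec_eq_iff tensor_Id_nth scaleR_add_right sum.distrib scaleR_sum_right mult.commute)

lemmas tensor_Id_simps =
  linear_add[OF linear_tensor_Id] linear_diff[OF linear_tensor_Id]
  linear_cmul[OF linear_tensor_Id] linear_0[OF linear_tensor_Id]

lemma tensor_Id_matrix_diff: "tensor_Id (K - L) z = tensor_Id K z - tensor_Id L z"
  by (simp add: vec_eq_iff tensor_Id_nth scaleR_diff_left sum_subtractf)

lemma tensor_Id_matrix_scaleR: "tensor_Id (c *\<^sub>R K) z = c *\<^sub>R tensor_Id K z"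
  by (simp add: vec_eq_iff tensor_Id_nth scaleR_sum_right)

lemma tensor_Id_mat_1: "tensor_Id (mat 1) z = z"
  by (simp add: vec_eq_iff tensor_Id_nth mat_def if_distrib[where f = "\<lambda>c. c *\<^sub>R _"] cong: if_cong)

lemma tensor_Id_mult: "tensor_Id (K ** L) z = tensor_Id K (tensor_Id L z)"
proof -
  have "(\<Sum>j\<in>UNIV. (\<Sum>k\<in>UNIV. K $ i $ k * L $ k $ j) *\<^sub>R z $ j)
      = (\<Sum>k\<in>UNIV. K $ i $ k *\<^sub>R (\<Sum>j\<in>UNIV. L $ k $ j *\<^sub>R z $ j))" for i
  proof -
    have "(\<Sum>j\<in>UNIV. (\<Sum>k\<in>UNIV. K $ i $ k * L $ k $ j) *\<^sub>R z $ j)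
        = (\<Sum>j\<in>UNIV. \<Sum>k\<in>UNIV. (K $ i $ k * L $ k $ j) *\<^sub>R z $ j)"
      by (simp add: scaleR_sum_left)
    also have "\<dots> = (\<Sum>k\<in>UNIV. \<Sum>j\<in>UNIV. (K $ i $ k * L $ k $ j) *\<^sub>R z $ j)"
      by (rule sum.swap)
    also have "\<dots> = (\<Sum>k\<in>UNIV. K $ i $ k *\<^sub>R (\<Sum>j\<in>UNIV. L $ k $ j *\<^sub>R z $ j))"
      by (simp add: scaleR_sum_right)
    finally show ?thesis .
  qed
  then show ?thesis
    by (simp add: vec_eq_iff tensor_Id_nth matrix_matrix_mult_def)
qed

lemma tensor_Id_const: "tensor_Id K (\<chi> i. c) = (\<chi> i. (K *v 1) $ i *\<^sub>R c)"
  by (simp add: vec_eq_iff tensor_Id_nth matrix_vector_mult_def scaleR_sum_left)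

lemma tensor_Id_adjoint: "tensor_Id K z \<bullet> y = z \<bullet> tensor_Id (transpose K) y"
proof -
  have "(\<Sum>i\<in>UNIV. \<Sum>j\<in>UNIV. K $ i $ j * (z $ j \<bullet> y $ i))
      = (\<Sum>j\<in>UNIV. \<Sum>i\<in>UNIV. K $ i $ j * (z $ j \<bullet> y $ i))"
    by (rule sum.swap)
  then show ?thesis
    by (simp add: inner_vec_def tensor_Id_nth inner_sum_left inner_sum_right transpose_def)
qed

section \<open>Quadratic forms, norms and projections on tuples\<close>

text \<open>Gram-Schmidt by induction on \<open>F\<close>. It reduces statements on tuples in an
  inner product space to real coordinate vectors.\<close>

lemma finite_orthonormal_expansion:
  fixes x :: "'i \<Rightarrow> 'h::real_inner"
  assumes "finite F"
  shows "\<exists>S. finite S \<and> (\<forall>e\<in>S. norm e = 1) \<and> (\<forall>e\<in>S. \<forall>e'\<in>S. e \<noteq> e' \<longrightarrow> e \<bullet> e' = 0)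
           \<and> (\<forall>i\<in>F. x i = (\<Sum>e\<in>S. (x i \<bullet> e) *\<^sub>R e))"
  using assms
proof (induction F)
  case empty
  show ?case by (intro exI[of _ "{}"]) auto
next
  case (insert i F)
  from insert.IH obtain S where S': "finite S" "\<forall>e\<in>S. norm e = 1"
      "\<forall>e\<in>S. \<forall>e'\<in>S. e \<noteq> e' \<longrightarrow> e \<bullet> e' = 0"
      "\<forall>i\<in>F. x i = (\<Sum>e\<in>S. (x i \<bullet> e) *\<^sub>R e)"
    by (elim exE conjE) (rule that; assumption)
  note S = S'(1) S'(2,3,4)[rule_format]
  define y where "y = x i - (\<Sum>e\<in>S. (x i \<bullet> e) *\<^sub>R e)"
  show ?case
  proof (cases "y = 0")
    case True
    then have xi: "x i = (\<Sum>e\<in>S. (x i \<bullet> e) *\<^sub>R e)"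
      by (simp add: y_def)
    have "\<forall>j\<in>insert i F. x j = (\<Sum>e\<in>S. (x j \<bullet> e) *\<^sub>R e)"
      by (rule ballI, erule insertE, hypsubst, rule xi, erule S(4))
    then show ?thesis
      using S'(1-3) by (intro exI[of _ S] conjI)
  next
    case False
    define n where "n = y /\<^sub>R norm y"
    have orth: "y \<bullet> e = 0" if "e \<in> S" for e
    proof -
      have "(\<Sum>e'\<in>S. (x i \<bullet> e') * (e' \<bullet> e)) = (\<Sum>e'\<in>S. if e' = e then x i \<bullet> e else 0)"
        using S(2,3) that by (intro sum.cong refl) (auto simp: norm_eq_1)
      then show ?thesis
        using that S(1) by (simp add: y_def inner_diff_left inner_sum_left)
    qed
    then have no: "n \<bullet> e = 0" "e \<bullet> n = 0" if "e \<in> S" for e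
      using that by (auto simp: n_def inner_commute)
    have n1: "norm n = 1"
      using False by (simp add: n_def)
    then have nS: "n \<notin> S"
      using no by (metis inner_eq_zero_iff norm_zero zero_neq_one)
    have sp: "x j \<bullet> n = 0" if "j \<in> F" for j
      by (subst S(4)[OF that]) (simp add: inner_sum_left no)
    have "x i \<bullet> n = y \<bullet> n"
      by (simp add: y_def inner_diff_left inner_sum_left no)
    also have "\<dots> = norm y"
      using False by (simp add: n_def power2_norm_eq_inner[symmetric] power2_eq_square)
    finally have "(x i \<bullet> n) *\<^sub>R n = y"
      using False by (simp add: n_def)
    then have xi: "x i = (\<Sum>e\<in>insert n S. (x i \<bullet> e) *\<^sub>R e)"
      using S(1) nS by (simp add: y_def)
    have xj: "x j = (\<Sum>e\<in>insert n S. (x j \<bullet> e) *\<^sub>R e)" if "j \<in> F" for j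
      using S(1) nS sp[OF that] by (simp flip: S(4)[OF that])
    have "\<forall>j\<in>insert i F. x j = (\<Sum>e\<in>insert n S. (x j \<bullet> e) *\<^sub>R e)"
      by (rule ballI, erule insertE, hypsubst, rule xi, erule xj)
    moreover have "finite (insert n S)" "\<forall>e\<in>insert n S. norm e = 1"
        "\<forall>e\<in>insert n S. \<forall>e'\<in>insert n S. e \<noteq> e' \<longrightarrow> e \<bullet> e' = 0"
      using S(1-3) no n1 by auto
    ultimately show ?thesis
      by (intro exI[of _ "insert n S"] conjI)
  qed
qed

text \<open>In orthonormal coordinates for the entries of \<open>x\<close>, the form is a sum over
  \<open>e\<close> of real forms \<open>v \<bullet> (S *v v)\<close>, with \<open>v\<close> the
  vector of \<open>e\<close>-coordinates.\<close>

lemma tensor_Id_quadratic_form_nonneg: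
  fixes S :: "real ^ 'n ^ 'n" and x :: "('a::real_inner) ^ 'n"
  assumes "\<And>v. 0 \<le> v \<bullet> (S *v v)"
  shows "0 \<le> x \<bullet> tensor_Id S x"
proof -
  obtain E where E: "finite E" "\<And>e. e \<in> E \<Longrightarrow> norm e = 1"
      "\<And>e e'. e \<in> E \<Longrightarrow> e' \<in> E \<Longrightarrow> e \<noteq> e' \<Longrightarrow> e \<bullet> e' = 0"
      "\<And>i. x $ i = (\<Sum>e\<in>E. (x $ i \<bullet> e) *\<^sub>R e)"
    using finite_orthonormal_expansion[of UNIV "\<lambda>i. x $ i"] by auto
  have ip: "x $ i \<bullet> x $ j = (\<Sum>e\<in>E. (x $ i \<bullet> e) * (x $ j \<bullet> e))" for i j
  proof -
    have "x $ i \<bullet> x $ j = (\<Sum>e\<in>E. (x $ j \<bullet> e) * (x $ i \<bullet> e))"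
      by (subst E(4)[of j]) (simp add: inner_sum_right)
    then show ?thesis
      by (simp add: mult.commute)
  qed
  have "x \<bullet> tensor_Id S x = (\<Sum>i\<in>UNIV. \<Sum>j\<in>UNIV. \<Sum>e\<in>E. S $ i $ j * ((x $ i \<bullet> e) * (x $ j \<bullet> e)))"
    by (simp add: inner_vec_def tensor_Id_nth inner_sum_right ip sum_distrib_left)
  also have "\<dots> = (\<Sum>i\<in>UNIV. \<Sum>e\<in>E. \<Sum>j\<in>UNIV. S $ i $ j * ((x $ i \<bullet> e) * (x $ j \<bullet> e)))"
    by (intro sum.cong refl sum.swap)
  also have "\<dots> = (\<Sum>e\<in>E. \<Sum>i\<in>UNIV. \<Sum>j\<in>UNIV. S $ i $ j * ((x $ i \<bullet> e) * (x $ j \<bullet> e)))"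
    by (rule sum.swap)
  also have "\<dots> = (\<Sum>e\<in>E. (\<chi> i. x $ i \<bullet> e) \<bullet> (S *v (\<chi> i. x $ i \<bullet> e)))"
    by (simp add: inner_vec_def matrix_vector_mult_def sum_distrib_left mult.left_commute)
  also have "\<dots> \<ge> 0"
    by (intro sum_nonneg assms)
  finally show ?thesis .
qed

lemma spectral_norm_nonneg: "0 \<le> spectral_norm K"
  unfolding spectral_norm_def by (rule onorm_pos_le) (simp add: linear_linear)

text \<open>The real bound says that \<open>?s\<^sup>2 *\<^sub>R mat 1 - transpose K ** K\<close>
  has a nonnegative form, a property that passes to tuples.\<close>

lemma norm_tensor_Id_le:
  fixes K :: "real ^ 'm ^ 'n" and x :: "('a::real_inner) ^ 'm"
  shows "norm (tensor_Id K x) \<le> spectral_norm K * norm x"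
proof -
  let ?s = "spectral_norm K"
  have "0 \<le> v \<bullet> ((?s\<^sup>2 *\<^sub>R mat 1 - transpose K ** K) *v v)" for v
  proof -
    have "norm (K *v v) \<le> ?s * norm v"
      unfolding spectral_norm_def by (rule onorm) (simp add: linear_linear)
    then have "(norm (K *v v))\<^sup>2 \<le> (?s * norm v)\<^sup>2"
      by (rule power_mono) simp
    then have "(K *v v) \<bullet> (K *v v) \<le> ?s\<^sup>2 * (v \<bullet> v)"
      by (simp add: power_mult_distrib power2_norm_eq_inner)
    moreover have "(K *v v) \<bullet> (K *v v) = v \<bullet> (transpose K *v (K *v v))"
      by (rule inner_matrix_vector_adjoint)
    ultimately show ?thesis
      by (simp add: matrix_vector_mult_diff_rdistrib inner_diff_right
          scaleR_matrix_vector_assoc[symmetric] flip: matrix_vector_mul_assoc)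
  qed
  then have "0 \<le> x \<bullet> tensor_Id (?s\<^sup>2 *\<^sub>R mat 1 - transpose K ** K) x"
    by (rule tensor_Id_quadratic_form_nonneg)
  also have "\<dots> = ?s\<^sup>2 * (x \<bullet> x) - tensor_Id K x \<bullet> tensor_Id K x"
    by (simp add: tensor_Id_matrix_diff tensor_Id_matrix_scaleR tensor_Id_mat_1 tensor_Id_mult
        inner_diff_right tensor_Id_adjoint)
  finally have "(norm (tensor_Id K x))\<^sup>2 \<le> (?s * norm x)\<^sup>2"
    by (simp add: power_mult_distrib power2_norm_eq_inner)
  then show ?thesis
    by (rule power2_le_imp_le) (simp add: spectral_norm_nonneg)
qed

lemma bounded_linear_tensor_Id:
  "bounded_linear (tensor_Id K :: ('a::real_inner) ^ 'm \<Rightarrow> 'a ^ 'n)"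
  using norm_tensor_Id_le[of K]
  by (intro bounded_linear_intro[where K = "spectral_norm K"])
    (simp_all add: tensor_Id_simps mult.commute)

lemmas tendsto_tensor_Id [tendsto_intros] = bounded_linear.tendsto[OF bounded_linear_tensor_Id]

lemma weak_lim_tensor_Id:
  "weak_lim x l F \<Longrightarrow> weak_lim (\<lambda>k. tensor_Id K (x k)) (tensor_Id K l) F"
  by (simp add: weak_lim_def tensor_Id_adjoint)

text \<open>\<open>M ** pinv M\<close> is symmetric and fixes the range of \<open>M\<close>, so on
  tuples too it is the orthogonal projection; a matrix thus replaces the definite description in
  \<open>emap\<close>.\<close>

lemma orth_proj_range_tensor_Id:
  fixes M :: "real ^ 'm ^ 'n" and y :: "('a::real_inner) ^ 'n"
  shows "orth_proj (range (tensor_Id M :: 'a ^ 'm \<Rightarrow> 'a ^ 'n)) y = tensor_Id (M ** pinv M) y"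
  unfolding orth_proj_def
proof (rule the_equality)
  let ?S = "range (tensor_Id M :: 'a ^ 'm \<Rightarrow> 'a ^ 'n)"
  let ?q = "tensor_Id (M ** pinv M) y"
  have q: "?q \<in> ?S"
    by (simp add: tensor_Id_mult)
  have orth: "orthogonal (y - ?q) s" if s: "s \<in> ?S" for s
  proof -
    obtain u where u: "s = tensor_Id M u" using s by blast
    have "tensor_Id (M ** pinv M) y \<bullet> tensor_Id M u = y \<bullet> tensor_Id (M ** pinv M ** M) u"
      by (subst tensor_Id_adjoint) (simp only: pinv_symmetric tensor_Id_mult)
    then show ?thesis
      by (simp add: u orthogonal_def inner_diff_left pinv_inner)
  qed
  with q show "?q \<in> ?S \<and> (\<forall>s\<in>?S. orthogonal (y - ?q) s)" by blast
  fix q' assume q': "q' \<in> ?S \<and> (\<forall>s\<in>?S. orthogonal (y - q') s)"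
  have "?q - q' \<in> ?S"
    using q q' by (auto simp: image_iff simp flip: tensor_Id_simps)
  then have "(y - q') \<bullet> (?q - q') = 0" "(y - ?q) \<bullet> (?q - q') = 0"
    using q' orth by (auto simp: orthogonal_def)
  then have "(?q - q') \<bullet> (?q - q') = 0"
    by (simp add: inner_diff_left)
  then show "q' = ?q" by simp
qed

section \<open>Consequences of a kernel that consists of the constants\<close>

lemma columns_of_kernel_complement:
  fixes K :: "real ^ 'n ^ 'm" and W :: "real ^ 'l ^ 'n"
  assumes ker: "{v. K *v v = 0} = range (\<lambda>c. c *\<^sub>R (1 :: real ^ 'n))" and W: "K ** W = 0"
  obtains c where "\<And>i j. W $ i $ j = c j"
proof -
  have "\<exists>c. column j W = c *\<^sub>R 1" for j
  proof -
    have "K *v column j W = 0"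
      using W by (simp add: matrix_vector_mult_def vec_eq_iff column_def matrix_matrix_mult_def)
    then show ?thesis
      using ker by blast
  qed
  then obtain c where c: "\<And>j. column j W = c j *\<^sub>R 1" by metis
  have "W $ i $ j = c j" for i j
    using arg_cong[OF c[of j], of "\<lambda>v. v $ i"] by (simp add: column_def)
  with that show ?thesis by blast
qed

text \<open>The rows of \<open>mat 1 - pinv K ** K\<close> coincide, so it maps every tuple to a
  constant one. With \<open>K = transpose M\<close> this splits \<open>x\<close> into a part
  controlled by \<open>transpose M\<close> and a consensus part.\<close>

lemma pinv_complement_constant:
  fixes K :: "real ^ 'n ^ 'm"
  assumes ker: "{v. K *v v = 0} = range (\<lambda>c. c *\<^sub>R (1 :: real ^ 'n))"
  obtains c where "\<And>x :: ('a::real_vector) ^ 'n.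
    x = tensor_Id (pinv K ** K) x + (\<chi> i. \<Sum>j\<in>UNIV. c j *\<^sub>R x $ j)"
proof -
  have "K ** (mat 1 - pinv K ** K) = 0"
    by (simp add: matrix_diff_ldistrib matrix_mul_assoc pinv_inner)
  then obtain c where c: "\<And>i j. (mat 1 - pinv K ** K) $ i $ j = c j"
    using columns_of_kernel_complement[OF ker] by blast
  have "x = tensor_Id (pinv K ** K) x + (\<chi> i. \<Sum>j\<in>UNIV. c j *\<^sub>R x $ j)" for x :: "'a ^ 'n"
  proof -
    have "x = tensor_Id (pinv K ** K) x + tensor_Id (mat 1 - pinv K ** K) x"
      by (simp add: tensor_Id_matrix_diff tensor_Id_mat_1)
    also have "tensor_Id (mat 1 - pinv K ** K) x = (\<chi> i. \<Sum>j\<in>UNIV. c j *\<^sub>R x $ j)"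
      by (simp only: tensor_Id_def c)
    finally show ?thesis .
  qed
  with that show ?thesis by blast
qed

text \<open>\<open>mat 1 - M ** pinv M\<close> has equal rows by the kernel condition and is
  symmetric, hence is a multiple of the all-ones matrix, which annihilates tuples with zero
  sum.\<close>

lemma tensor_Id_pinv_right_inverse:
  fixes M :: "real ^ 'm ^ 'n" and y :: "('a::real_vector) ^ 'n"
  assumes ker: "{v. transpose M *v v = 0} = range (\<lambda>c. c *\<^sub>R (1 :: real ^ 'n))"
    and y: "(\<Sum>i\<in>UNIV. y $ i) = 0"
  shows "tensor_Id M (tensor_Id (pinv M) y) = y"
proof -
  let ?W = "mat 1 - M ** pinv M"
  have sym: "transpose ?W = ?W"
    by (simp add: transpose_matrix_diff pinv_symmetric transpose_mat)
  have "transpose (transpose M ** ?W) = ?W ** M"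
    by (simp add: matrix_transpose_mul sym)
  also have "\<dots> = 0"
    by (simp add: matrix_diff_rdistrib pinv_inner)
  finally have "transpose M ** ?W = 0"
    by (metis transpose_transpose transpose_matrix_diff diff_self)
  then obtain c where c: "\<And>i j. ?W $ i $ j = c j"
    using columns_of_kernel_complement[OF ker] by blast
  have "c j = c i" for i j
  proof -
    have "c j = transpose ?W $ i $ j"
      by (simp only: sym c)
    also have "\<dots> = ?W $ j $ i"
      by (simp add: transpose_def)
    also have "\<dots> = c i"
      by (rule c)
    finally show ?thesis .
  qed
  \<comment> \<open>All \<open>c j\<close> coincide, so \<open>undefined\<close> serves as an
    arbitrary index.\<close>
  then have "?W $ i $ j = c undefined" for i j
    using c by metis
  then have "tensor_Id ?W y = (\<chi> i. c undefined *\<^sub>R (\<Sum>j\<in>UNIV. y $ j))"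
    by (simp only: tensor_Id_def scaleR_sum_right)
  then have "tensor_Id ?W y = 0"
    using y by (simp add: vec_eq_iff)
  then show ?thesis
    by (simp add: tensor_Id_matrix_diff tensor_Id_mat_1 tensor_Id_mult)
qed

section \<open>The splitting scheme\<close>

lemma cocoercive_monotone:
  assumes "cocoercive \<beta> B" "0 < \<beta>"
  shows "0 \<le> (x - y) \<bullet> (B x - B y)"
proof -
  have "0 \<le> 1 / \<beta> * (norm (B x - B y))\<^sup>2"
    using assms(2) by simp
  also have "\<dots> \<le> (B x - B y) \<bullet> (x - y)"
    using assms(1) by (simp add: cocoercive_def)
  finally show ?thesis
    by (simp add: inner_commute)
qed

lemma cocoercive_lipschitz:
  assumes "cocoercive \<beta> B" "0 < \<beta>"
  shows "norm (B x - B y) \<le> \<beta> * norm (x - y)"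
proof (cases "B x = B y")
  case False
  have "(norm (B x - B y))\<^sup>2 \<le> \<beta> * ((B x - B y) \<bullet> (x - y))"
    using assms by (simp add: cocoercive_def field_simps)
  also have "\<dots> \<le> \<beta> * (norm (B x - B y) * norm (x - y))"
    using assms(2) by (intro mult_left_mono norm_cauchy_schwarz) auto
  finally have "norm (B x - B y) * norm (B x - B y) \<le> norm (B x - B y) * (\<beta> * norm (x - y))"
    by (simp add: power2_eq_square mult_ac)
  with False show ?thesis
    by (simp add: mult_le_cancel_left)
qed (use assms in simp)

lemma sum_tensor_Id: "(\<Sum>i\<in>UNIV. tensor_Id K z $ i) = (\<Sum>j\<in>UNIV. (transpose K *v 1) $ j *\<^sub>R z $ j)"
  unfolding tensor_Id_nth
  by (subst sum.swap) (simp add: transpose_def matrix_vector_mult_def scaleR_sum_left)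

section \<open>The recursion as an inclusion, and uniqueness of its solution\<close>

locale splitting =
  fixes A :: "'n::{finite,linorder} \<Rightarrow> 'a::{real_inner,complete_space} \<Rightarrow> 'a set"
    and B :: "'p::{finite,linorder} \<Rightarrow> 'a \<Rightarrow> 'a"
    and d :: "'n rvec"
    and M :: "('n, 'm::finite) rmat"
    and N :: "('n, 'n) rmat"
    and P :: "('n, 'p) rmat"
    and R :: "('p, 'n) rmat"
    and \<beta> :: real
  assumes A_max: "\<And>i. maximally_monotone (A i)"
    and beta_pos: "0 < \<beta>"
    and B_cocoercive: "\<And>j. cocoercive \<beta> (B j)"
    and d_pos: "\<And>i. 0 < d $ i"
    and ker_M: "{v. transpose M *v v = 0} = range (\<lambda>c. c *\<^sub>R (1 :: 'n rvec))"
    and P_one: "transpose P *v 1 = 1"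
    and R_one: "R *v 1 = 1"
    and psd: "pos_semidef (2 *\<^sub>R diag_mat d - N - transpose N - M ** transpose M)"
    and N_sum: "(\<Sum>i\<in>UNIV. \<Sum>j\<in>UNIV. N $ i $ j) = (\<Sum>i\<in>UNIV. d $ i)"
    and N_tri: "lower_triangular N" "zero_diagonal N"
    and P_tri: "lower_triangular P" "zero_diagonal P"
    and R_tri: "lower_triangular R"
begin

abbreviation X :: "real \<Rightarrow> ('a, 'm) vec \<Rightarrow> ('a, 'n) vec" where
  "X \<equiv> xmap A B d M N P R"

abbreviation Q :: "real \<Rightarrow> real \<Rightarrow> ('a, 'm) vec \<Rightarrow> ('a, 'm) vec" where
  "Q \<equiv> Qmap A B d M N P R"

abbreviation C :: "('n, 'n) rmat" where
  "C \<equiv> diag_mat d - N"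

definition Bv :: "('a, 'n) vec \<Rightarrow> ('a, 'p) vec" where
  "Bv x = (\<chi> j. B j (tensor_Id R x $ j))"

text \<open>The implicit form of \<open>x = X \<gamma> z\<close>, which avoids the recursion of \<open>xcomp\<close>.\<close>

definition solves :: "real \<Rightarrow> ('a, 'm) vec \<Rightarrow> ('a, 'n) vec \<Rightarrow> bool" where
  "solves \<gamma> z x \<longleftrightarrow> (\<exists>a. (\<forall>i. a $ i \<in> A i (x $ i)) \<and>
     tensor_Id C x + \<gamma> *\<^sub>R (a + tensor_Id P (Bv x)) = tensor_Id M z)"

lemma N_zero: "\<not> j < i \<Longrightarrow> N $ i $ j = 0"
  using N_tri by (metis idx_less_iff lower_triangular_def zero_diagonal_def linorder_neqE)

lemma P_zero: "\<not> idx j < idx i \<Longrightarrow> P $ i $ j = 0"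
  using P_tri by (metis lower_triangular_def zero_diagonal_def linorder_neqE)

lemma R_zero: "\<not> idx t \<le> idx j \<Longrightarrow> R $ j $ t = 0"
  using R_tri by (simp add: lower_triangular_def)

lemma tensor_Id_N_nth: "tensor_Id N x $ i = (\<Sum>j\<in>{j. j < i}. N $ i $ j *\<^sub>R x $ j)"
  unfolding tensor_Id_nth by (rule sum.mono_neutral_right) (auto simp: N_zero)

lemma tensor_Id_P_nth: "tensor_Id P x $ i = (\<Sum>j\<in>{j. idx j < idx i}. P $ i $ j *\<^sub>R x $ j)"
  unfolding tensor_Id_nth by (rule sum.mono_neutral_right) (auto simp: P_zero)

lemma tensor_Id_R_nth: "tensor_Id R x $ j = (\<Sum>t\<in>{t. idx t \<le> idx j}. R $ j $ t *\<^sub>R x $ t)"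
  unfolding tensor_Id_nth by (rule sum.mono_neutral_right) (auto simp: R_zero)

lemma tensor_Id_C_nth: "tensor_Id C x $ i = d $ i *\<^sub>R x $ i - tensor_Id N x $ i"
proof -
  have "tensor_Id (diag_mat d) x $ i = d $ i *\<^sub>R x $ i"
    by (simp add: tensor_Id_nth diag_mat_def if_distrib[where f = "\<lambda>c. c *\<^sub>R _"] cong: if_cong)
  then show ?thesis
    by (simp add: tensor_Id_matrix_diff)
qed

text \<open>One update of the recursion with entries of \<open>x\<close> in place of the recursive
  calls, so that \<open>X \<gamma> z\<close> becomes a fixed point of it.\<close>

definition step :: "real \<Rightarrow> ('a, 'm) vec \<Rightarrow> ('a, 'n) vec \<Rightarrow> 'n \<Rightarrow> 'a" where
  "step \<gamma> z x i = resolvent (scale_op (\<gamma> / d $ i) (A i))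
       ((1 / d $ i) *\<^sub>R (tensor_Id M z $ i)
        + (1 / d $ i) *\<^sub>R (\<Sum>j\<in>{j. j < i}. N $ i $ j *\<^sub>R x $ j)
        - (\<gamma> / d $ i) *\<^sub>R (\<Sum>j\<in>{j. idx j < idx i}. P $ i $ j *\<^sub>R
            B j (\<Sum>t\<in>{t. idx t \<le> idx j}. R $ j $ t *\<^sub>R x $ t)))"

lemma X_step: "X \<gamma> z $ i = step \<gamma> z (X \<gamma> z) i"
  unfolding step_def xmap_def vec_lambda_beta by (subst xcomp.simps) simp

lemma step_cong:
  assumes "\<And>j. idx j < idx i \<Longrightarrow> x $ j = y $ j"
  shows "step \<gamma> z x i = step \<gamma> z y i"
proof -
  have "(\<Sum>j\<in>{j. j < i}. N $ i $ j *\<^sub>R x $ j) = (\<Sum>j\<in>{j. j < i}. N $ i $ j *\<^sub>R y $ j)"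
    using assms by (intro sum.cong) (auto simp: idx_less_iff)
  moreover have "(\<Sum>t\<in>{t. idx t \<le> idx j}. R $ j $ t *\<^sub>R x $ t) = (\<Sum>t\<in>{t. idx t \<le> idx j}. R $ j $ t *\<^sub>R y $ t)"
    if "idx j < idx i" for j
    using assms that by (intro sum.cong) auto
  ultimately show ?thesis
    by (simp add: step_def)
qed

text \<open>Triangularity turns the full matrix sums into the truncated sums of the recursion;
  dividing row \<open>i\<close> by \<open>d $ i\<close> then matches the resolvent
  inclusion.\<close>

lemma solves_iff_step:
  assumes "0 < \<gamma>"
  shows "solves \<gamma> z x \<longleftrightarrow> (\<forall>i. x $ i = step \<gamma> z x i)"
proof -
  let ?rhs = "\<lambda>i. tensor_Id M z $ i + tensor_Id N x $ i - \<gamma> *\<^sub>R tensor_Id P (Bv x) $ i"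
  have "solves \<gamma> z x \<longleftrightarrow> (\<exists>a. \<forall>i. a $ i \<in> A i (x $ i) \<and> d $ i *\<^sub>R x $ i + \<gamma> *\<^sub>R a $ i = ?rhs i)"
    unfolding solves_def vec_eq_iff
    by (intro ex_cong1) (auto simp: tensor_Id_C_nth algebra_simps)
  also have "\<dots> \<longleftrightarrow> (\<forall>i. \<exists>a\<in>A i (x $ i). d $ i *\<^sub>R x $ i + \<gamma> *\<^sub>R a = ?rhs i)"
  proof
    assume "\<forall>i. \<exists>a\<in>A i (x $ i). d $ i *\<^sub>R x $ i + \<gamma> *\<^sub>R a = ?rhs i"
    then obtain a where "\<forall>i. a i \<in> A i (x $ i) \<and> d $ i *\<^sub>R x $ i + \<gamma> *\<^sub>R a i = ?rhs i"
      by metis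
    then show "\<exists>a. \<forall>i. a $ i \<in> A i (x $ i) \<and> d $ i *\<^sub>R x $ i + \<gamma> *\<^sub>R a $ i = ?rhs i"
      by (intro exI[of _ "vec_lambda a"]) simp
  qed blast
  also have "\<dots> \<longleftrightarrow> (\<forall>i. step \<gamma> z x i = x $ i)"
  proof (intro all_cong1)
    fix i
    have d: "0 < d $ i" by (rule d_pos)
    have "step \<gamma> z x i = resolvent (scale_op (\<gamma> / d $ i) (A i)) ((1 / d $ i) *\<^sub>R ?rhs i)"
      by (simp add: step_def tensor_Id_N_nth tensor_Id_P_nth Bv_def tensor_Id_R_nth scaleR_add_right
          scaleR_diff_right)
    then have "step \<gamma> z x i = x $ i
        \<longleftrightarrow> (\<exists>a\<in>A i (x $ i). x $ i + (\<gamma> / d $ i) *\<^sub>R a = (1 / d $ i) *\<^sub>R ?rhs i)"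
      using d assms by (simp add: resolvent_eq_iff[OF A_max])
    also have "\<dots> \<longleftrightarrow> (\<exists>a\<in>A i (x $ i). (1 / d $ i) *\<^sub>R (d $ i *\<^sub>R x $ i + \<gamma> *\<^sub>R a) = (1 / d $ i) *\<^sub>R ?rhs i)"
      using d by (simp add: scaleR_add_right)
    also have "\<dots> \<longleftrightarrow> (\<exists>a\<in>A i (x $ i). d $ i *\<^sub>R x $ i + \<gamma> *\<^sub>R a = ?rhs i)"
      using d by simp
    finally show "(\<exists>a\<in>A i (x $ i). d $ i *\<^sub>R x $ i + \<gamma> *\<^sub>R a = ?rhs i) \<longleftrightarrow> step \<gamma> z x i = x $ i"
      by simp
  qed
  finally show ?thesis
    by metis
qed

lemma solves_X: "0 < \<gamma> \<Longrightarrow> solves \<gamma> z (X \<gamma> z)"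
  by (simp add: solves_iff_step X_step[symmetric])

text \<open>Row \<open>i\<close> determines entry \<open>i\<close> from the earlier entries, so
  induction on \<open>idx\<close> applies.\<close>

lemma solves_unique:
  assumes "0 < \<gamma>" "solves \<gamma> z x"
  shows "x = X \<gamma> z"
proof -
  have "x $ i = X \<gamma> z $ i" for i
  proof (induction i rule: measure_induct_rule[of idx])
    case (less i)
    then have "step \<gamma> z x i = step \<gamma> z (X \<gamma> z) i"
      by (rule step_cong)
    then show ?case
      using assms by (metis solves_iff_step X_step)
  qed
  then show ?thesis
    by (simp add: vec_eq_iff)
qed

section \<open>Lipschitz bounds for the solution map and for relocation\<close>

lemma Bv_lipschitz: "norm (Bv x - Bv y) \<le> \<beta> * spectral_norm R * norm (x - y)"
proof -
  have "norm (Bv x - Bv y) \<le> L2_set (\<lambda>j. \<beta> * norm (tensor_Id R (x - y) $ j)) UNIV"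
    unfolding norm_vec_def
  proof (rule L2_set_mono)
    fix j
    show "norm ((Bv x - Bv y) $ j) \<le> \<beta> * norm (tensor_Id R (x - y) $ j)"
      using cocoercive_lipschitz[OF B_cocoercive beta_pos, of j]
      by (simp add: Bv_def tensor_Id_simps)
  qed simp
  also have "\<dots> = \<beta> * norm (tensor_Id R (x - y))"
    using beta_pos by (simp add: L2_set_right_distrib norm_vec_def)
  also have "\<dots> \<le> \<beta> * (spectral_norm R * norm (x - y))"
    using beta_pos by (intro mult_left_mono norm_tensor_Id_le) auto
  finally show ?thesis by simp
qed

text \<open>Induction along the rows: pairing the difference of two inclusions in row
  \<open>i\<close> with the difference of the entries, monotonicity of \<open>A i\<close> discards
  the \<open>A\<close> term, and \<open>d $ i\<close> times the difference is bounded by data and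
  earlier entries. The step size enters the constant only through its bound
  \<open>g\<close>.\<close>

lemma solution_component_lipschitz:
  "\<exists>L\<ge>0. \<forall>\<gamma> z x z' x'. 0 < \<gamma> \<longrightarrow> \<gamma> \<le> g \<longrightarrow> solves \<gamma> z x \<longrightarrow> solves \<gamma> z' x' \<longrightarrow>
     norm (x $ i - x' $ i) \<le> L * norm (z - z')"
proof (induction i rule: measure_induct_rule[of idx])
  case (less i)
  then obtain L where L0: "\<And>j. idx j < idx i \<Longrightarrow> 0 \<le> L j"
    and L: "\<And>j \<gamma> z x z' x'. idx j < idx i \<Longrightarrow> 0 < \<gamma> \<Longrightarrow> \<gamma> \<le> g \<Longrightarrow> solves \<gamma> z x \<Longrightarrow> solves \<gamma> z' x' \<Longrightarrow>
     norm (x $ j - x' $ j) \<le> L j * norm (z - z')"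
    by metis
  define LN where "LN = (\<Sum>j\<in>{j. j < i}. \<bar>N $ i $ j\<bar> * L j)"
  define LR where "LR j = \<beta> * (\<Sum>t\<in>{t. idx t \<le> idx j}. \<bar>R $ j $ t\<bar> * L t)" for j
  define LP where "LP = (\<Sum>j\<in>{j. idx j < idx i}. \<bar>P $ i $ j\<bar> * LR j)"
  \<comment> \<open>The absolute value keeps \<open>K\<close> nonnegative also for negative
    \<open>g\<close>, where the estimate is vacuous.\<close>
  define K where "K = (spectral_norm M + LN + \<bar>g\<bar> * LP) / d $ i"
  have LR0: "0 \<le> LR j" if "idx j < idx i" for j
    unfolding LR_def using that L0 beta_pos by (intro mult_nonneg_nonneg sum_nonneg) auto
  have LP0: "0 \<le> LP"
    unfolding LP_def using LR0 by (intro sum_nonneg mult_nonneg_nonneg) auto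
  have LN0: "0 \<le> LN"
    unfolding LN_def using L0 by (intro sum_nonneg mult_nonneg_nonneg) (auto simp: idx_less_iff)
  have "0 \<le> K"
    unfolding K_def using LP0 LN0 d_pos[of i] spectral_norm_nonneg[of M] by (intro divide_nonneg_pos add_nonneg_nonneg) auto
  moreover have "norm (x $ i - x' $ i) \<le> K * norm (z - z')"
    if \<gamma>: "0 < \<gamma>" "\<gamma> \<le> g" and sol: "solves \<gamma> z x" "solves \<gamma> z' x'" for \<gamma> z x z' x'
  proof -
    obtain a a' where a: "a $ i \<in> A i (x $ i)" "a' $ i \<in> A i (x' $ i)"
      and "tensor_Id C x + \<gamma> *\<^sub>R (a + tensor_Id P (Bv x)) = tensor_Id M z"
      and "tensor_Id C x' + \<gamma> *\<^sub>R (a' + tensor_Id P (Bv x')) = tensor_Id M z'"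
      using sol unfolding solves_def by blast
    then have eq: "d $ i *\<^sub>R x $ i - tensor_Id N x $ i + \<gamma> *\<^sub>R (a $ i + tensor_Id P (Bv x) $ i) = tensor_Id M z $ i"
        "d $ i *\<^sub>R x' $ i - tensor_Id N x' $ i + \<gamma> *\<^sub>R (a' $ i + tensor_Id P (Bv x') $ i) = tensor_Id M z' $ i"
      by (auto simp: vec_eq_iff tensor_Id_C_nth)
    define D where "D = x $ i - x' $ i"
    define r where "r = tensor_Id M (z - z') $ i + tensor_Id N (x - x') $ i - \<gamma> *\<^sub>R tensor_Id P (Bv x - Bv x') $ i"
    have D: "d $ i *\<^sub>R D + \<gamma> *\<^sub>R (a $ i - a' $ i) = r"
      unfolding D_def r_def tensor_Id_simps vector_minus_component eq[symmetric] by (simp add: algebra_simps)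
    have "0 \<le> D \<bullet> (a $ i - a' $ i)"
      unfolding D_def by (rule maximally_monotoneD[OF A_max a])
    then have "d $ i * (D \<bullet> D) \<le> D \<bullet> (d $ i *\<^sub>R D + \<gamma> *\<^sub>R (a $ i - a' $ i))"
      using \<gamma> by (simp add: inner_add_right)
    also have "\<dots> \<le> norm D * norm r"
      unfolding D by (rule norm_cauchy_schwarz)
    finally have "norm D * (d $ i * norm D) \<le> norm D * norm r"
      by (simp add: power2_norm_eq_inner[symmetric] power2_eq_square mult_ac)
    then have Dr: "d $ i * norm D \<le> norm r"
      by (cases "D = 0") (auto simp: mult_le_cancel_left)
    let ?n = "norm (z - z')"
    have Lx: "norm (c *\<^sub>R (x - x') $ j) \<le> \<bar>c\<bar> * L j * ?n" if "idx j < idx i" for c j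
      using mult_left_mono[OF L[OF that \<gamma> sol], of "\<bar>c\<bar>"] by (simp add: mult.assoc)
    have "norm (tensor_Id M (z - z') $ i) \<le> norm (tensor_Id M (z - z'))"
      by (rule Finite_Cartesian_Product.norm_nth_le)
    also have "\<dots> \<le> spectral_norm M * ?n"
      by (rule norm_tensor_Id_le)
    finally have 1: "norm (tensor_Id M (z - z') $ i) \<le> spectral_norm M * ?n" .
    have 2: "norm (tensor_Id N (x - x') $ i) \<le> LN * ?n"
      unfolding LN_def tensor_Id_N_nth sum_distrib_right
      by (intro sum_norm_le Lx) (auto simp: idx_less_iff)
    have RR: "norm (tensor_Id R (x - x') $ j) \<le> (\<Sum>t\<in>{t. idx t \<le> idx j}. \<bar>R $ j $ t\<bar> * L t) * ?n"
      if "idx j < idx i" for j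
      unfolding tensor_Id_R_nth sum_distrib_right using that by (intro sum_norm_le Lx) auto
    have "norm (Bv x $ j - Bv x' $ j) \<le> LR j * ?n" if "idx j < idx i" for j
    proof -
      have "norm (Bv x $ j - Bv x' $ j) \<le> \<beta> * norm (tensor_Id R (x - x') $ j)"
        using cocoercive_lipschitz[OF B_cocoercive beta_pos, of j] by (simp add: Bv_def tensor_Id_simps)
      also have "\<dots> \<le> \<beta> * ((\<Sum>t\<in>{t. idx t \<le> idx j}. \<bar>R $ j $ t\<bar> * L t) * ?n)"
        using RR[OF that] beta_pos by (intro mult_left_mono) auto
      finally show ?thesis
        by (simp add: LR_def mult.assoc)
    qed
    then have "norm (P $ i $ j *\<^sub>R (Bv x - Bv x') $ j) \<le> \<bar>P $ i $ j\<bar> * LR j * ?n" if "idx j < idx i" for j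
      using that by (simp add: mult.assoc mult_left_mono)
    then have 3: "norm (tensor_Id P (Bv x - Bv x') $ i) \<le> LP * ?n"
      unfolding LP_def tensor_Id_P_nth sum_distrib_right by (intro sum_norm_le) auto
    have "norm (\<gamma> *\<^sub>R tensor_Id P (Bv x - Bv x') $ i) \<le> \<bar>g\<bar> * (LP * ?n)"
      unfolding norm_scaleR using \<gamma> by (intro mult_mono 3) auto
    then have "norm r \<le> spectral_norm M * ?n + LN * ?n + \<bar>g\<bar> * (LP * ?n)"
      unfolding r_def using 1 2
      by (intro order_trans[OF norm_triangle_ineq4] add_mono order_trans[OF norm_triangle_ineq]) auto
    also have "\<dots> = (spectral_norm M + LN + \<bar>g\<bar> * LP) * ?n"
      by (simp add: algebra_simps)
    finally show ?thesis
      using Dr d_pos[of i] by (simp add: K_def D_def field_simps)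
  qed
  ultimately show ?case by blast
qed

lemma solution_lipschitz:
  obtains L where "0 \<le> L"
    "\<And>\<gamma> z x z' x'. 0 < \<gamma> \<Longrightarrow> \<gamma> \<le> g \<Longrightarrow> solves \<gamma> z x \<Longrightarrow> solves \<gamma> z' x' \<Longrightarrow>
       norm (x - x') \<le> L * norm (z - z')"
proof -
  have "\<exists>L. \<forall>i. 0 \<le> L i \<and> (\<forall>\<gamma> z x z' x'. 0 < \<gamma> \<longrightarrow> \<gamma> \<le> g \<longrightarrow> solves \<gamma> z x \<longrightarrow> solves \<gamma> z' x' \<longrightarrow>
      norm (x $ i - x' $ i) \<le> L i * norm (z - z'))"
    by (intro choice allI solution_component_lipschitz)
  then obtain L where L0: "\<And>i. 0 \<le> L i"
    and L: "\<And>i \<gamma> z x z' x'. 0 < \<gamma> \<Longrightarrow> \<gamma> \<le> g \<Longrightarrow> solves \<gamma> z x \<Longrightarrow> solves \<gamma> z' x' \<Longrightarrow>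
      norm (x $ i - x' $ i) \<le> L i * norm (z - z')"
    by blast
  have "norm (x - x') \<le> (\<Sum>i\<in>UNIV. L i) * norm (z - z')"
    if "0 < \<gamma>" "\<gamma> \<le> g" "solves \<gamma> z x" "solves \<gamma> z' x'" for \<gamma> z x z' x'
  proof -
    have "norm (x - x') \<le> (\<Sum>i\<in>UNIV. norm ((x - x') $ i))"
      unfolding norm_vec_def by (rule L2_set_le_sum) simp
    also have "\<dots> \<le> (\<Sum>i\<in>UNIV. L i * norm (z - z'))"
      using L[OF that] by (intro sum_mono) simp
    finally show ?thesis
      by (simp add: sum_distrib_right)
  qed
  with L0 that[of "\<Sum>i\<in>UNIV. L i"] show ?thesis
    by (simp add: sum_nonneg)
qed

lemma Qmap_eq:
  "Q \<delta> \<gamma> w = (\<delta> / \<gamma>) *\<^sub>R w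
     + (1 - \<delta> / \<gamma>) *\<^sub>R tensor_Id (pinv M) (tensor_Id (M ** pinv M) (tensor_Id C (X \<gamma> w)))"
proof -
  have "(\<chi> i. d $ i *\<^sub>R (x $ i) - (\<Sum>j\<in>{j. j < i}. N $ i $ j *\<^sub>R (x $ j))) = tensor_Id C x" for x :: "('a, 'n) vec"
    by (simp add: vec_eq_iff tensor_Id_C_nth tensor_Id_N_nth)
  then show ?thesis
    by (simp add: Qmap_def emap_def orth_proj_range_tensor_Id)
qed

text \<open>\<open>Q\<close> is the identity plus \<open>(\<delta> - \<gamma>) / \<gamma>\<close>
  times a Lipschitz map, so the bound exceeds one by a multiple of the step change;
  \<open>g0\<close> controls the quotient.\<close>

lemma Qmap_lipschitz:
  assumes "0 < g0"
  obtains K where "0 \<le> K"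
    "\<And>\<gamma> \<delta> w w'. g0 \<le> \<gamma> \<Longrightarrow> \<gamma> \<le> g \<Longrightarrow> norm (Q \<delta> \<gamma> w - Q \<delta> \<gamma> w') \<le> (1 + K * \<bar>\<delta> - \<gamma>\<bar>) * norm (w - w')"
proof -
  obtain L where L0: "0 \<le> L" and L: "\<And>\<gamma> z x z' x'. 0 < \<gamma> \<Longrightarrow> \<gamma> \<le> g \<Longrightarrow> solves \<gamma> z x \<Longrightarrow>
      solves \<gamma> z' x' \<Longrightarrow> norm (x - x') \<le> L * norm (z - z')"
    using solution_lipschitz by blast
  define S where "S = pinv M ** (M ** pinv M) ** C"
  define K where "K = (1 + spectral_norm S * L) / g0"
  have "0 \<le> K"
    unfolding K_def using assms L0 spectral_norm_nonneg[of S] by simp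
  moreover have "norm (Q \<delta> \<gamma> w - Q \<delta> \<gamma> w') \<le> (1 + K * \<bar>\<delta> - \<gamma>\<bar>) * norm (w - w')"
    if \<gamma>: "g0 \<le> \<gamma>" "\<gamma> \<le> g" for \<gamma> \<delta> w w'
  proof -
    have pos: "0 < \<gamma>" using assms \<gamma> by simp
    let ?n = "norm (w - w')"
    have "Q \<delta> \<gamma> w - Q \<delta> \<gamma> w' = (w - w') + ((\<delta> - \<gamma>) / \<gamma>) *\<^sub>R ((w - w') - tensor_Id S (X \<gamma> w - X \<gamma> w'))"
      using pos by (simp add: Qmap_eq S_def tensor_Id_mult tensor_Id_simps algebra_simps diff_divide_distrib)
    also have "norm \<dots> \<le> ?n + \<bar>\<delta> - \<gamma>\<bar> / \<gamma> * (?n + spectral_norm S * (L * ?n))"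
    proof (intro order_trans[OF norm_triangle_ineq] add_left_mono)
      have "norm (tensor_Id S (X \<gamma> w - X \<gamma> w')) \<le> spectral_norm S * norm (X \<gamma> w - X \<gamma> w')"
        by (rule norm_tensor_Id_le)
      also have "\<dots> \<le> spectral_norm S * (L * ?n)"
        using L[OF pos \<gamma>(2) solves_X[OF pos] solves_X[OF pos]] spectral_norm_nonneg
        by (intro mult_left_mono) auto
      finally have "norm ((w - w') - tensor_Id S (X \<gamma> w - X \<gamma> w')) \<le> ?n + spectral_norm S * (L * ?n)"
        by (intro order_trans[OF norm_triangle_ineq4]) simp
      then show "norm (((\<delta> - \<gamma>) / \<gamma>) *\<^sub>R ((w - w') - tensor_Id S (X \<gamma> w - X \<gamma> w')))
          \<le> \<bar>\<delta> - \<gamma>\<bar> / \<gamma> * (?n + spectral_norm S * (L * ?n))"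
        unfolding norm_scaleR abs_divide using pos by (intro mult_mono divide_right_mono) auto
    qed
    also have "\<dots> \<le> ?n + \<bar>\<delta> - \<gamma>\<bar> / g0 * (?n + spectral_norm S * (L * ?n))"
      using \<gamma>(1) assms L0 spectral_norm_nonneg[of S]
      by (intro add_left_mono mult_right_mono divide_left_mono) (auto intro!: add_nonneg_nonneg)
    also have "\<dots> = (1 + K * \<bar>\<delta> - \<gamma>\<bar>) * ?n"
      by (simp add: K_def field_simps)
    finally show ?thesis .
  qed
  ultimately show ?thesis using that by blast
qed

section \<open>Constant solutions, zeros and relocated fixed points\<close>

abbreviation const :: "'a \<Rightarrow> ('a, 'n) vec" where
  "const c \<equiv> (\<chi> i. c)"

lemma M_one: "transpose M *v 1 = 0"
  using ker_M by (metis (mono_tags, lifting) mem_Collect_eq rangeI scaleR_one)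

lemma tensor_Id_M_const: "tensor_Id (transpose M) (const c) = 0"
  by (simp add: tensor_Id_const M_one vec_eq_iff del: transpose_matrix_vector)

lemma tensor_Id_R_const: "tensor_Id R (const c) = (\<chi> i. c)"
  by (simp add: tensor_Id_const R_one)

lemma tensor_Id_P_const: "tensor_Id (transpose P) (const c) = (\<chi> i. c)"
  by (simp add: tensor_Id_const P_one del: transpose_matrix_vector)

lemma sum_tensor_Id_M: "(\<Sum>i\<in>UNIV. tensor_Id M z $ i) = 0"
  by (simp add: sum_tensor_Id M_one del: transpose_matrix_vector)

lemma sum_tensor_Id_P: "(\<Sum>i\<in>UNIV. tensor_Id P b $ i) = (\<Sum>j\<in>UNIV. b $ j)"
  by (simp add: sum_tensor_Id P_one del: transpose_matrix_vector)

lemma sum_tensor_Id_C_const: "(\<Sum>i\<in>UNIV. tensor_Id C (const c) $ i) = 0"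
proof -
  have "(\<Sum>i\<in>UNIV. tensor_Id C (const c) $ i)
      = (\<Sum>i\<in>UNIV. d $ i) *\<^sub>R c - (\<Sum>i\<in>UNIV. \<Sum>j\<in>UNIV. N $ i $ j) *\<^sub>R c"
    unfolding tensor_Id_C_nth by (simp add: sum_subtractf scaleR_sum_left tensor_Id_nth)
  then show ?thesis
    by (simp add: N_sum)
qed

lemma M_pinv: "(\<Sum>i\<in>UNIV. y $ i) = 0 \<Longrightarrow> tensor_Id M (tensor_Id (pinv M) y) = y" for y :: "('a, 'n) vec"
  by (rule tensor_Id_pinv_right_inverse[OF ker_M])

lemma Bv_const: "Bv (const c) = (\<chi> j. B j c)"
  by (simp add: Bv_def tensor_Id_R_const)

text \<open>Summing the rows eliminates \<open>M\<close> and, by the condition on \<open>N\<close>,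
  the \<open>C\<close> term, while \<open>P\<close> preserves sums. What remains is
  \<open>\<gamma>\<close> times an element of the operator sum.\<close>

lemma constant_solution_is_zero:
  assumes "0 < \<gamma>" "solves \<gamma> z (const c)"
  shows "c \<in> zer (sum_op A B)"
proof -
  obtain a where a: "\<And>i. a $ i \<in> A i c"
    and eq: "tensor_Id C (const c) + \<gamma> *\<^sub>R (a + tensor_Id P (Bv (const c))) = tensor_Id M z"
    using assms(2) by (auto simp: solves_def)
  have "(\<Sum>i\<in>UNIV. (tensor_Id C (const c) + \<gamma> *\<^sub>R (a + tensor_Id P (Bv (const c)))) $ i) = 0"
    unfolding eq by (rule sum_tensor_Id_M)
  then have "\<gamma> *\<^sub>R ((\<Sum>i\<in>UNIV. a $ i) + (\<Sum>j\<in>UNIV. B j c)) = 0"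
    by (simp add: sum.distrib sum_tensor_Id_C_const sum_tensor_Id_P Bv_const flip: scaleR_sum_right)
  then have "0 = (\<Sum>i\<in>UNIV. a $ i) + (\<Sum>j\<in>UNIV. B j c)"
    using assms(1) by simp
  moreover have "(\<Sum>i\<in>UNIV. a $ i) \<in> (\<Sum>i\<in>UNIV. A i c)"
    unfolding set_sum_alt[OF finite] using a by blast
  ultimately show ?thesis
    unfolding zer_def sum_op_def mem_Collect_eq set_plus_def by blast
qed

text \<open>The left side of the inclusion has zero sum, which places it in the range of
  \<open>M\<close>; \<open>pinv M\<close> returns a preimage.\<close>

lemma zero_gives_constant_solution:
  assumes "c \<in> zer (sum_op A B)"
  obtains z where "solves \<gamma> z (const c)"
proof -
  obtain a where a: "\<And>i. a i \<in> A i c" "0 = (\<Sum>i\<in>UNIV. a i) + (\<Sum>j\<in>UNIV. B j c)"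
    using assms unfolding zer_def sum_op_def mem_Collect_eq set_plus_def set_sum_alt[OF finite] by auto
  define y where "y = tensor_Id C (const c) + \<gamma> *\<^sub>R ((\<chi> i. a i) + tensor_Id P (Bv (const c)))"
  have "(\<Sum>i\<in>UNIV. y $ i) = \<gamma> *\<^sub>R ((\<Sum>i\<in>UNIV. a i) + (\<Sum>j\<in>UNIV. B j c))"
    by (simp add: y_def sum.distrib sum_tensor_Id_C_const sum_tensor_Id_P Bv_const flip: scaleR_sum_right)
  then have "tensor_Id M (tensor_Id (pinv M) y) = y"
    using a(2) by (intro M_pinv) simp
  then have "solves \<gamma> (tensor_Id (pinv M) y) (const c)"
    unfolding solves_def y_def using a(1) by (intro exI[of _ "\<chi> i. a i"]) simp
  with that show ?thesis .
qed

text \<open>The path of \<open>z\<close> under \<open>Q\<close>, where \<open>g\<close> is the step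
  at which \<open>z\<close> gives the constant solution \<open>c\<close>. Along it the solution
  stays \<open>const c\<close>, so the \<open>emap\<close> term is a fixed tuple and the path is
  affine in \<open>\<gamma>\<close>.\<close>

definition relocated :: "real \<Rightarrow> 'a \<Rightarrow> ('a, 'm) vec \<Rightarrow> real \<Rightarrow> ('a, 'm) vec" where
  "relocated g c z \<gamma> = (\<gamma> / g) *\<^sub>R z + (1 - \<gamma> / g) *\<^sub>R tensor_Id (pinv M) (tensor_Id C (const c))"

text \<open>The selection \<open>a\<close> found at step \<open>g\<close> serves every
  \<open>\<gamma>\<close>: under \<open>M\<close> the path only rescales the operator part of the
  inclusion.\<close>

lemma solves_relocated:
  assumes "0 < g" "0 < \<gamma>" "solves g z (const c)"
  shows "solves \<gamma> (relocated g c z \<gamma>) (const c)"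
proof -
  obtain a where a: "\<And>i. a $ i \<in> A i c"
    and eq: "tensor_Id C (const c) + g *\<^sub>R (a + tensor_Id P (Bv (const c))) = tensor_Id M z"
    using assms(3) by (auto simp: solves_def)
  have "tensor_Id M (relocated g c z \<gamma>)
      = (\<gamma> / g) *\<^sub>R tensor_Id M z + (1 - \<gamma> / g) *\<^sub>R tensor_Id C (const c)"
    by (simp add: relocated_def tensor_Id_simps M_pinv[OF sum_tensor_Id_C_const])
  also have "\<dots> = tensor_Id C (const c) + \<gamma> *\<^sub>R (a + tensor_Id P (Bv (const c)))"
    unfolding eq[symmetric] using assms(1) by (simp add: algebra_simps)
  finally show ?thesis
    using a unfolding solves_def by (intro exI[of _ a]) simp
qed

text \<open>\<open>Q\<close> moves points along the path, so \<open>Qmap_lipschitz\<close> compares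
  distances to it before and after relocation.\<close>

lemma Q_relocated:
  assumes "0 < g" "0 < \<gamma>" "solves g z (const c)"
  shows "Q \<delta> \<gamma> (relocated g c z \<gamma>) = relocated g c z \<delta>"
proof -
  have "X \<gamma> (relocated g c z \<gamma>) = const c"
    using solves_unique[OF assms(2) solves_relocated[OF assms]] by simp
  then have "Q \<delta> \<gamma> (relocated g c z \<gamma>) = (\<delta> / \<gamma>) *\<^sub>R relocated g c z \<gamma>
      + (1 - \<delta> / \<gamma>) *\<^sub>R tensor_Id (pinv M) (tensor_Id C (const c))"
    by (simp add: Qmap_eq tensor_Id_mult M_pinv[OF sum_tensor_Id_C_const])
  also have "\<dots> = relocated g c z \<delta>"
    using assms by (simp add: relocated_def algebra_simps)
  finally show ?thesis .
qed

lemma tendsto_relocated: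
  assumes "(\<gamma> \<longlongrightarrow> g) F" "0 < g"
  shows "((\<lambda>k. relocated g c z (\<gamma> k)) \<longlongrightarrow> z) F"
proof -
  have "((\<lambda>k. relocated g c z (\<gamma> k)) \<longlongrightarrow> relocated g c z g) F"
    unfolding relocated_def using assms by (intro tendsto_intros) auto
  then show ?thesis
    using assms(2) by (simp add: relocated_def)
qed

text \<open>\<open>transpose M\<close> annihilates constant tuples, so the displacement in
  \<open>Tmap\<close> vanishes; at the first index the sums of the recursion are empty, which leaves
  the resolvent formula.\<close>

lemma fixed_point_of_constant_solution:
  assumes "0 < \<gamma>" "solves \<gamma> z (const c)"
  shows "z \<in> Fix (Tmap A B d M N P R \<theta> \<gamma>)"
    and "c = resolvent (scale_op (\<gamma> / d $ Min UNIV) (A (Min UNIV))) ((1 / d $ Min UNIV) *\<^sub>R (tensor_Id M z $ Min UNIV))"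
proof -
  have X: "X \<gamma> z = const c"
    using solves_unique[OF assms] by simp
  then show "z \<in> Fix (Tmap A B d M N P R \<theta> \<gamma>)"
    by (simp add: Fix_def Tmap_def tensor_Id_M_const)
  have no_n: "{j :: 'n. j < Min UNIV} = {}"
    by (auto simp: not_less intro: Min_le)
  \<comment> \<open>\<open>idx\<close> counts from one in both index types, so no index of type
    \<open>'p\<close> has a number below that of the first index.\<close>
  have no_p: "{j :: 'p. idx j < idx (Min (UNIV :: 'n set))} = {}"
  proof -
    have "{j :: 'n. j \<le> Min UNIV} = {Min UNIV}"
      by (auto intro: antisym)
    then have "idx (Min (UNIV :: 'n set)) = 1"
      by (simp add: idx_def)
    moreover have "1 \<le> idx j" for j :: 'p
      using bij_betw_idx[where 'n = 'p] by (auto simp: bij_betw_def)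
    ultimately show ?thesis
      by (auto simp: Suc_le_eq)
  qed
  have "step \<gamma> z (const c) (Min UNIV) = resolvent (scale_op (\<gamma> / d $ Min UNIV) (A (Min UNIV)))
      ((1 / d $ Min UNIV) *\<^sub>R (tensor_Id M z $ Min UNIV))"
    unfolding step_def no_n no_p by simp
  then show "c = resolvent (scale_op (\<gamma> / d $ Min UNIV) (A (Min UNIV))) ((1 / d $ Min UNIV) *\<^sub>R (tensor_Id M z $ Min UNIV))"
    using X_step[of \<gamma> z "Min UNIV"] X by simp
qed

end

text \<open>In every component other than the one of interest, one tests with a graph point whose
  contribution to the sum is nonpositive.\<close>

lemma product_maximally_monotone:
  fixes A :: "'k::finite \<Rightarrow> 'a::real_inner \<Rightarrow> 'a set" and x u :: "'k \<Rightarrow> 'a"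
  assumes A: "\<And>i. maximally_monotone (A i)"
    and test: "\<And>y v. (\<And>i. v i \<in> A i (y i)) \<Longrightarrow> 0 \<le> (\<Sum>i\<in>UNIV. (x i - y i) \<bullet> (u i - v i))"
  shows "u i \<in> A i (x i)"
proof (rule ccontr)
  assume not: "u i \<notin> A i (x i)"
  have ex: "\<exists>y v. v \<in> A j y \<and> (if u j \<in> A j (x j) then y = x j \<and> v = u j else (x j - y) \<bullet> (u j - v) < 0)" for j
    using maximally_monotone_memI[OF A, of j "x j" "u j"] by (auto simp: not_le[symmetric])
  then obtain y v where yv: "\<And>j. v j \<in> A j (y j)"
    and neg: "\<And>j. if u j \<in> A j (x j) then y j = x j \<and> v j = u j else (x j - y j) \<bullet> (u j - v j) < 0"
    by metis
  have "(x j - y j) \<bullet> (u j - v j) \<le> 0" for j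
    using neg[of j] by (auto split: if_splits)
  moreover have "(x i - y i) \<bullet> (u i - v i) < 0"
    using neg[of i] not by simp
  ultimately have "(\<Sum>i\<in>UNIV. (x i - y i) \<bullet> (u i - v i)) < (\<Sum>i\<in>(UNIV :: 'k set). 0)"
    by (intro sum_strict_mono_ex1) auto
  with test[OF yv] show False by simp
qed

text \<open>Minty's device: testing at \<open>x + t *\<^sub>R h\<close> with
  \<open>h = u - B x\<close> and letting \<open>t\<close> tend to zero forces \<open>h = 0\<close>.
  It identifies weak limits of values of \<open>B\<close>.\<close>

lemma lipschitz_monotone_test:
  fixes B :: "'a::real_inner \<Rightarrow> 'a"
  assumes lip: "\<And>x y. norm (B x - B y) \<le> \<beta> * norm (x - y)"
    and test: "\<And>y. 0 \<le> (x - y) \<bullet> (u - B y)"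
  shows "u = B x"
proof -
  define h where "h = u - B x"
  have le: "(norm h)\<^sup>2 \<le> t * (\<beta> * (norm h)\<^sup>2)" if t: "0 < t" for t
  proof -
    have "0 \<le> - t * (h \<bullet> (u - B (x + t *\<^sub>R h)))"
      using test[of "x + t *\<^sub>R h"] by simp
    then have "h \<bullet> (u - B (x + t *\<^sub>R h)) \<le> 0"
      using t by (simp add: mult_le_0_iff)
    then have "(norm h)\<^sup>2 \<le> h \<bullet> (B (x + t *\<^sub>R h) - B x)"
      by (simp add: h_def power2_norm_eq_inner inner_diff_right)
    also have "\<dots> \<le> norm h * norm (B (x + t *\<^sub>R h) - B x)"
      by (rule norm_cauchy_schwarz)
    also have "\<dots> \<le> norm h * (\<beta> * norm (x + t *\<^sub>R h - x))"
      by (intro mult_left_mono lip) simp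
    also have "\<dots> = t * (\<beta> * (norm h)\<^sup>2)"
      using t by (simp add: power2_eq_square)
    finally show ?thesis .
  qed
  have "((\<lambda>t. t * (\<beta> * (norm h)\<^sup>2)) \<longlongrightarrow> 0 * (\<beta> * (norm h)\<^sup>2)) (at_right 0)"
    by (intro tendsto_intros)
  then have "(norm h)\<^sup>2 \<le> 0 * (\<beta> * (norm h)\<^sup>2)"
    by (rule tendsto_lowerbound) (auto simp: eventually_at_right_less le intro: eventually_mono[OF eventually_at_right_less])
  then show ?thesis
    by (simp add: h_def)
qed

section \<open>Monotonicity, descent and weak closedness of the inclusion\<close>

context splitting
begin

text \<open>The difference of the two inclusions is paired with \<open>x - x'\<close>; the
  contribution of the \<open>A i\<close> is nonnegative and is dropped.\<close>

lemma solves_monotone: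
  assumes "solves \<gamma> z x" "solves \<gamma> z' x'" "0 < \<gamma>"
  shows "(x - x') \<bullet> tensor_Id C (x - x') + \<gamma> * (tensor_Id (transpose P) (x - x') \<bullet> (Bv x - Bv x'))
    \<le> tensor_Id (transpose M) (x - x') \<bullet> (z - z')"
proof -
  obtain a a' where a: "\<And>i. a $ i \<in> A i (x $ i)" "\<And>i. a' $ i \<in> A i (x' $ i)"
    and eq: "tensor_Id C x + \<gamma> *\<^sub>R (a + tensor_Id P (Bv x)) = tensor_Id M z"
      "tensor_Id C x' + \<gamma> *\<^sub>R (a' + tensor_Id P (Bv x')) = tensor_Id M z'"
    using assms(1,2) unfolding solves_def by blast
  have "0 \<le> (x - x') \<bullet> (a - a')"
    unfolding inner_vec_def using maximally_monotoneD[OF A_max a] by (intro sum_nonneg) simp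
  then have "0 \<le> \<gamma> * ((x - x') \<bullet> (a - a'))"
    using assms(3) by simp
  have "tensor_Id M (z - z')
      = tensor_Id C (x - x') + \<gamma> *\<^sub>R (a - a') + \<gamma> *\<^sub>R tensor_Id P (Bv x - Bv x')"
    by (simp add: tensor_Id_simps eq[symmetric] algebra_simps)
  then have "(x - x') \<bullet> tensor_Id M (z - z') = (x - x') \<bullet> tensor_Id C (x - x')
      + \<gamma> * ((x - x') \<bullet> (a - a')) + \<gamma> * ((x - x') \<bullet> tensor_Id P (Bv x - Bv x'))"
    by (simp add: inner_add_right)
  moreover have "(x - x') \<bullet> tensor_Id M (z - z') = tensor_Id (transpose M) (x - x') \<bullet> (z - z')"
      "(x - x') \<bullet> tensor_Id P (Bv x - Bv x') = tensor_Id (transpose P) (x - x') \<bullet> (Bv x - Bv x')"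
    by (simp_all add: tensor_Id_adjoint)
  ultimately show ?thesis
    using \<open>0 \<le> \<gamma> * _\<close> by simp
qed

text \<open>A matrix and its transpose have the same quadratic form, so the semidefiniteness
  hypothesis concerns \<open>2 *\<^sub>R C - M ** transpose M\<close>.\<close>

lemma C_quadratic: "(norm (tensor_Id (transpose M) x))\<^sup>2 / 2 \<le> x \<bullet> tensor_Id C x"
  for x :: "('a, 'n) vec"
proof -
  have "0 \<le> x \<bullet> tensor_Id (2 *\<^sub>R diag_mat d - N - transpose N - M ** transpose M) x"
    using psd by (intro tensor_Id_quadratic_form_nonneg) (simp add: pos_semidef_def)
  also have "\<dots> = 2 * (x \<bullet> tensor_Id (diag_mat d) x) - x \<bullet> tensor_Id N x - x \<bullet> tensor_Id (transpose N) x
      - x \<bullet> tensor_Id M (tensor_Id (transpose M) x)"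
    by (simp add: tensor_Id_matrix_diff tensor_Id_matrix_scaleR tensor_Id_mult inner_diff_right)
  also have "x \<bullet> tensor_Id (transpose N) x = x \<bullet> tensor_Id N x"
    by (metis inner_commute tensor_Id_adjoint)
  also have "x \<bullet> tensor_Id M (tensor_Id (transpose M) x) = (norm (tensor_Id (transpose M) x))\<^sup>2"
    by (metis inner_commute power2_norm_eq_inner tensor_Id_adjoint)
  finally show ?thesis
    by (simp add: tensor_Id_matrix_diff inner_diff_right)
qed

text \<open>\<open>transpose P\<close> and \<open>R\<close> agree on constant tuples, so only the
  part of \<open>x\<close> seen by \<open>transpose M\<close> survives. The matrix in
  \<open>\<mu>\<close> arises here.\<close>

lemma P_minus_R_factor:
  fixes x :: "('a, 'n) vec"
  shows "tensor_Id (transpose P - R) x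
    = tensor_Id ((transpose P - R) ** pinv (transpose M)) (tensor_Id (transpose M) x)"
proof -
  obtain c where c: "\<And>x :: ('a, 'n) vec.
      x = tensor_Id (pinv (transpose M) ** transpose M) x + (\<chi> i. \<Sum>j\<in>UNIV. c j *\<^sub>R x $ j)"
    using pinv_complement_constant[OF ker_M] by blast
  have "tensor_Id (transpose P - R) x = tensor_Id (transpose P - R) (tensor_Id (pinv (transpose M) ** transpose M) x)
     + tensor_Id (transpose P - R) (const (\<Sum>j\<in>UNIV. c j *\<^sub>R x $ j))"
    by (subst c) (rule tensor_Id_simps)
  also have "tensor_Id (transpose P - R) (const (\<Sum>j\<in>UNIV. c j *\<^sub>R x $ j)) = 0"
    by (simp add: tensor_Id_matrix_diff tensor_Id_P_const tensor_Id_R_const)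
  finally show ?thesis
    by (simp add: tensor_Id_mult)
qed

text \<open>Cocoercivity gives the term \<open>1 / \<beta> * (norm b)\<^sup>2\<close>, the mismatch
  of \<open>transpose P\<close> and \<open>R\<close> a cross term \<open>s * m * norm b\<close>.
  Completing the square absorbs the latter at the cost \<open>\<mu> * m\<^sup>2 / 4\<close>.\<close>

lemma solves_descent_inner:
  assumes "solves \<gamma> z x" "solves \<gamma> zs (const c)" "0 < \<gamma>"
    and \<mu>: "\<mu> = \<beta> * (spectral_norm ((transpose P - R) ** pinv (transpose M)))\<^sup>2"
  shows "(1 / 2 - \<gamma> * \<mu> / 4) * (norm (tensor_Id (transpose M) x))\<^sup>2 \<le> tensor_Id (transpose M) x \<bullet> (z - zs)"
proof -
  define D where "D = x - const c"
  define b where "b = Bv x - Bv (const c)"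
  define m where "m = norm (tensor_Id (transpose M) x)"
  define s where "s = spectral_norm ((transpose P - R) ** pinv (transpose M))"
  have MD: "tensor_Id (transpose M) D = tensor_Id (transpose M) x"
    by (simp add: D_def tensor_Id_simps tensor_Id_M_const)
  have "1 / \<beta> * (norm b)\<^sup>2 = (\<Sum>j\<in>UNIV. 1 / \<beta> * (norm (b $ j))\<^sup>2)"
    by (simp add: power2_norm_eq_inner inner_vec_def sum_distrib_left)
  also have "\<dots> \<le> (\<Sum>j\<in>UNIV. b $ j \<bullet> tensor_Id R D $ j)"
    using B_cocoercive by (intro sum_mono) (simp add: b_def Bv_def D_def tensor_Id_simps cocoercive_def)
  finally have RD: "1 / \<beta> * (norm b)\<^sup>2 \<le> tensor_Id R D \<bullet> b"
    by (simp add: inner_vec_def inner_commute)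
  have "norm (tensor_Id (transpose P - R) D) \<le> s * m"
    unfolding P_minus_R_factor MD s_def m_def by (rule norm_tensor_Id_le)
  then have "norm (tensor_Id (transpose P - R) D) * norm b \<le> s * m * norm b"
    by (rule mult_right_mono) simp
  then have "- (s * m * norm b) \<le> tensor_Id (transpose P - R) D \<bullet> b"
    using Cauchy_Schwarz_ineq2[of "tensor_Id (transpose P - R) D" b] by simp
  with RD have PD: "1 / \<beta> * (norm b)\<^sup>2 - s * m * norm b \<le> tensor_Id (transpose P) D \<bullet> b"
    by (simp add: tensor_Id_matrix_diff inner_diff_left)
  have "0 \<le> (norm b - \<beta> * s * m / 2)\<^sup>2 / \<beta>"
    using beta_pos by simp
  also have "\<dots> = 1 / \<beta> * (norm b)\<^sup>2 - s * m * norm b + \<mu> * m\<^sup>2 / 4"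
    using beta_pos by (simp add: \<mu> s_def power2_eq_square field_simps)
  finally have "\<gamma> * (- (\<mu> * m\<^sup>2 / 4)) \<le> \<gamma> * (tensor_Id (transpose P) D \<bullet> b)"
    using PD assms(3) by (intro mult_left_mono) auto
  moreover have "m\<^sup>2 / 2 \<le> D \<bullet> tensor_Id C D"
    using C_quadratic[of D] by (simp add: MD m_def)
  ultimately have "m\<^sup>2 / 2 - \<gamma> * (\<mu> * m\<^sup>2 / 4) \<le> tensor_Id (transpose M) D \<bullet> (z - zs)"
    using solves_monotone[OF assms(1-3)] by (simp add: D_def b_def)
  then show ?thesis
    by (simp add: MD m_def algebra_simps)
qed

text \<open>Expanding the square leaves a term in \<open>t\<^sup>2\<close> against
  \<open>2 * t\<close> times the pairing of \<open>solves_descent_inner\<close>; together they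
  produce the factor of the step size condition.\<close>

lemma solves_descent:
  assumes "solves \<gamma> z x" "solves \<gamma> zs (const c)" "0 < \<gamma>" "0 < t"
    and \<mu>: "\<mu> = \<beta> * (spectral_norm ((transpose P - R) ** pinv (transpose M)))\<^sup>2"
  shows "(norm (z - t *\<^sub>R tensor_Id (transpose M) x - zs))\<^sup>2
    \<le> (norm (z - zs))\<^sup>2 - t / 2 * (2 - \<gamma> * \<mu> - 2 * t) * (norm (tensor_Id (transpose M) x))\<^sup>2"
proof -
  let ?g = "tensor_Id (transpose M) x"
  define u where "u = z - zs"
  have shift: "z - t *\<^sub>R ?g - zs = u - t *\<^sub>R ?g"
    by (simp add: u_def)
  have expand: "(norm (u - t *\<^sub>R ?g))\<^sup>2 = (norm u)\<^sup>2 - 2 * t * (?g \<bullet> u) + t\<^sup>2 * (norm ?g)\<^sup>2"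
    by (simp add: power2_norm_eq_inner inner_simps inner_commute) (simp add: power2_eq_square)
  have "(norm (z - t *\<^sub>R ?g - zs))\<^sup>2 = (norm (z - zs))\<^sup>2 - 2 * t * (?g \<bullet> (z - zs)) + t\<^sup>2 * (norm ?g)\<^sup>2"
    unfolding shift expand by (simp add: u_def)
  moreover have "2 * t * ((1 / 2 - \<gamma> * \<mu> / 4) * (norm ?g)\<^sup>2) \<le> 2 * t * (?g \<bullet> (z - zs))"
    using assms(4) solves_descent_inner[OF assms(1-3) \<mu>] by simp
  ultimately show ?thesis
    by (simp add: algebra_simps power2_eq_square)
qed

text \<open>Weak limits need not pass through products. The structure of the inclusion makes the one
  critical scalar, the pairing \<open>s\<close>, converge to its value at the limit, after which the
  monotonicity tests pass to the limit.\<close>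

lemma demiclosed:
  fixes F :: "'i filter"
  assumes F: "F \<noteq> bot" and \<gamma>: "\<And>k. 0 < \<gamma> k" "(\<gamma> \<longlongrightarrow> g) F" "0 < g"
    and sol: "\<And>k. solves (\<gamma> k) (z k) (x k)"
    and Mx: "((\<lambda>k. tensor_Id (transpose M) (x k)) \<longlongrightarrow> 0) F"
    and z: "weak_lim z zb F" "\<And>k. norm (z k) \<le> Cz"
    and x: "weak_lim x xb F" "\<And>k. norm (x k) \<le> Cx"
    and b: "weak_lim (\<lambda>k. Bv (x k)) bb F" "\<And>k. norm (Bv (x k)) \<le> Cb"
  obtains c where "xb = const c" "solves g zb (const c)"
proof -
  let ?MT = "transpose M" and ?E = "pinv (transpose M)"
  obtain w where w: "\<And>x :: ('a, 'n) vec. x = tensor_Id (?E ** ?MT) x + (\<chi> i. \<Sum>j\<in>UNIV. w j *\<^sub>R x $ j)"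
    using pinv_complement_constant[OF ker_M] by blast
  \<comment> \<open>\<open>x k\<close> is a constant tuple plus \<open>r k\<close>, and
    \<open>r k\<close> tends to zero in norm with
    \<open>tensor_Id (transpose M) (x k)\<close>.\<close>
  define avg where "avg x = (\<Sum>j\<in>UNIV. w j *\<^sub>R x $ j)" for x :: "('a, 'n) vec"
  define r where "r k = tensor_Id ?E (tensor_Id ?MT (x k))" for k
  have xr: "x k = r k + const (avg (x k))" for k
    using w[of "x k"] by (simp add: r_def avg_def tensor_Id_mult)
  have "(r \<longlongrightarrow> tensor_Id ?E 0) F"
    unfolding r_def[abs_def] by (intro tendsto_intros Mx)
  then have r0: "(r \<longlongrightarrow> 0) F"
    by (simp add: tensor_Id_simps)
  have "weak_lim (\<lambda>k. tensor_Id ?MT (x k)) 0 F"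
    using tendsto_inner[OF Mx tendsto_const] by (simp add: weak_lim_def)
  then have Mxb: "tensor_Id ?MT xb = 0"
    using weak_lim_unique[OF F weak_lim_tensor_Id[OF x(1)]] by blast
  define c where "c = avg xb"
  have xb: "xb = const c"
    using w[of xb] by (simp add: c_def avg_def tensor_Id_mult Mxb tensor_Id_simps)

  have "\<exists>a. \<forall>k. (\<forall>i. a k $ i \<in> A i (x k $ i)) \<and>
      tensor_Id C (x k) + \<gamma> k *\<^sub>R (a k + tensor_Id P (Bv (x k))) = tensor_Id M (z k)"
    using sol unfolding solves_def by (intro choice allI)
  then obtain a where a: "\<And>k i. a k $ i \<in> A i (x k $ i)"
    and eq: "\<And>k. tensor_Id C (x k) + \<gamma> k *\<^sub>R (a k + tensor_Id P (Bv (x k))) = tensor_Id M (z k)"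
    by blast
  have a_eq: "a k = (1 / \<gamma> k) *\<^sub>R (tensor_Id M (z k) - tensor_Id C (x k)) - tensor_Id P (Bv (x k))" for k
    using \<gamma>(1)[of k] by (simp add: eq[symmetric])
  define ab where "ab = (1 / g) *\<^sub>R (tensor_Id M zb - tensor_Id C xb) - tensor_Id P bb"
  have g': "((\<lambda>k. 1 / \<gamma> k) \<longlongrightarrow> 1 / g) F"
    using \<gamma>(3) by (intro tendsto_intros \<gamma>(2)) simp
  have alim: "weak_lim a ab F"
    unfolding weak_lim_def a_eq[abs_def] ab_def inner_diff_left inner_scaleR_left
    by (intro allI tendsto_intros g' weak_limD weak_lim_tensor_Id z x b)

  have norm_avg: "norm (const (avg (x k))) \<le> Cx + spectral_norm (?E ** ?MT) * Cx" for k
  proof -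
    have "norm (const (avg (x k))) = norm (x k - r k)"
      using xr[of k] by (metis add_diff_cancel_left')
    also have "\<dots> \<le> norm (x k) + norm (tensor_Id (?E ** ?MT) (x k))"
      by (simp add: r_def tensor_Id_mult norm_triangle_ineq4)
    also have "\<dots> \<le> Cx + spectral_norm (?E ** ?MT) * Cx"
      by (intro add_mono x order_trans[OF norm_tensor_Id_le] mult_left_mono spectral_norm_nonneg)
    finally show ?thesis .
  qed
  have CE: "((\<lambda>k. tensor_Id C (r k)) \<longlongrightarrow> 0) F"
    using tendsto_tensor_Id[OF r0, of C] by (simp add: tensor_Id_simps)
  \<comment> \<open>Hence every surviving term in the expansion of
    \<open>x k \<bullet> tensor_Id C (x k)\<close> contains \<open>r k\<close>.\<close>
  have C_const: "const u \<bullet> tensor_Id C (const v) = 0" for u v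
    by (simp add: inner_vec_def sum_tensor_Id_C_const flip: inner_sum_right)
  have "x k \<bullet> tensor_Id C (x k) = r k \<bullet> tensor_Id C (x k) + tensor_Id C (r k) \<bullet> const (avg (x k))" for k
  proof -
    have "x k \<bullet> tensor_Id C (x k) = r k \<bullet> tensor_Id C (x k) + const (avg (x k)) \<bullet> tensor_Id C (x k)"
      by (subst (1) xr) (simp add: inner_add_left)
    also have "const (avg (x k)) \<bullet> tensor_Id C (x k) = const (avg (x k)) \<bullet> tensor_Id C (r k + const (avg (x k)))"
      using xr[of k] by simp
    also have "\<dots> = tensor_Id C (r k) \<bullet> const (avg (x k))"
      by (simp only: tensor_Id_simps inner_add_right C_const inner_commute add_0_right)
    finally show ?thesis .
  qed
  moreover have "((\<lambda>k. r k \<bullet> tensor_Id C (x k)) \<longlongrightarrow> 0) F"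
    by (rule weak_strong_inner[OF r0, of _ "spectral_norm C * Cx"])
      (intro order_trans[OF norm_tensor_Id_le] mult_left_mono x spectral_norm_nonneg)
  moreover have "((\<lambda>k. tensor_Id C (r k) \<bullet> const (avg (x k))) \<longlongrightarrow> 0) F"
    by (rule weak_strong_inner[OF CE norm_avg])
  ultimately have xCx: "((\<lambda>k. x k \<bullet> tensor_Id C (x k)) \<longlongrightarrow> 0) F"
    using tendsto_add by fastforce
  have PR0: "((\<lambda>k. tensor_Id (transpose P - R) (x k)) \<longlongrightarrow> 0) F"
    unfolding P_minus_R_factor using tendsto_tensor_Id[OF Mx] by (simp add: tensor_Id_simps)
  \<comment> \<open>The values of \<open>B\<close> are paired with \<open>tensor_Id R (x k)\<close>,
    as their monotonicity requires, whereas the inclusion yields \<open>transpose P\<close>; the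
    exchange costs the last term of \<open>s_eq\<close>, which tends to zero.\<close>
  define s where "s k = x k \<bullet> a k + tensor_Id R (x k) \<bullet> Bv (x k)" for k
  have s_eq: "s k = (1 / \<gamma> k) * (tensor_Id ?MT (x k) \<bullet> z k - x k \<bullet> tensor_Id C (x k))
      - tensor_Id (transpose P - R) (x k) \<bullet> Bv (x k)" for k
    by (simp add: s_def a_eq inner_diff_right inner_diff_left tensor_Id_matrix_diff tensor_Id_adjoint
        scaleR_diff_right right_diff_distrib)
  have "(s \<longlongrightarrow> 1 / g * (0 - 0) - 0) F"
    unfolding s_eq[abs_def]
    by (intro tendsto_mult tendsto_diff g' xCx weak_strong_inner[OF Mx z(2)] weak_strong_inner[OF PR0 b(2)])
  then have s0: "(s \<longlongrightarrow> 0) F" by simp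
  have sb: "xb \<bullet> ab + tensor_Id R xb \<bullet> bb = 0"
  proof -
    have "xb \<bullet> ab + tensor_Id R xb \<bullet> bb = (1 / g) * (tensor_Id ?MT xb \<bullet> zb - xb \<bullet> tensor_Id C xb)
      - tensor_Id (transpose P - R) xb \<bullet> bb"
      by (simp add: ab_def inner_diff_right inner_diff_left tensor_Id_matrix_diff tensor_Id_adjoint
          scaleR_diff_right right_diff_distrib)
    also have "\<dots> = 0"
      unfolding P_minus_R_factor Mxb by (simp add: tensor_Id_simps) (simp add: xb C_const)
    finally show ?thesis .
  qed
  have test: "0 \<le> (xb - y) \<bullet> (ab - v) + (tensor_Id R xb - y') \<bullet> (bb - (\<chi> j. B j (y' $ j)))"
    if v: "\<And>i. v $ i \<in> A i (y $ i)" for y v and y' :: "('a, 'p) vec"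
  proof -
    define b' where "b' = (\<chi> j. B j (y' $ j))"
    \<comment> \<open>The expanded monotonicity pairing with its critical products collected in
      \<open>s\<close>; the other terms are continuous under weak convergence.\<close>
    define f where "f s a b x Rx = s - x \<bullet> v - a \<bullet> y + y \<bullet> v - Rx \<bullet> b' - b \<bullet> y' + y' \<bullet> b'"
      for s and a x :: "('a, 'n) vec" and b Rx :: "('a, 'p) vec"
    have "0 \<le> f (s k) (a k) (Bv (x k)) (x k) (tensor_Id R (x k))" for k
    proof -
      have "0 \<le> (x k - y) \<bullet> (a k - v)"
        unfolding inner_vec_def using maximally_monotoneD[OF A_max a v] by (intro sum_nonneg) simp
      moreover have "0 \<le> (tensor_Id R (x k) - y') \<bullet> (Bv (x k) - b')"
        unfolding inner_vec_def b'_def Bv_def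
        using cocoercive_monotone[OF B_cocoercive beta_pos] by (intro sum_nonneg) simp
      ultimately show ?thesis
        by (simp add: f_def s_def inner_diff_left inner_diff_right inner_commute)
    qed
    moreover have "((\<lambda>k. f (s k) (a k) (Bv (x k)) (x k) (tensor_Id R (x k))) \<longlongrightarrow> f 0 ab bb xb (tensor_Id R xb)) F"
      unfolding f_def
      by (intro tendsto_intros s0 weak_limD[OF alim] weak_limD[OF b(1)] weak_limD[OF x(1)] weak_limD[OF weak_lim_tensor_Id[OF x(1)]])
    ultimately have "0 \<le> f 0 ab bb xb (tensor_Id R xb)"
      by (intro tendsto_lowerbound[OF _ always_eventually F]) auto
    then show ?thesis
      using sb unfolding b'_def[symmetric] f_def by (simp add: inner_diff_left inner_diff_right inner_commute)
  qed
  have Bxb: "(\<chi> j. B j (tensor_Id R xb $ j)) = Bv xb"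
    by (simp add: Bv_def)
  \<comment> \<open>Choosing \<open>y' = tensor_Id R xb\<close> makes the \<open>B\<close> part of
    the test vanish.\<close>
  have ab_mem: "ab $ i \<in> A i (xb $ i)" for i
  proof (rule product_maximally_monotone[of A "\<lambda>i. xb $ i" "\<lambda>i. ab $ i"])
    fix y v assume "\<And>i. v i \<in> A i (y i)"
    then have "0 \<le> (xb - vec_lambda y) \<bullet> (ab - vec_lambda v)"
      using test[of "vec_lambda v" "vec_lambda y" "tensor_Id R xb"] by simp
    then show "0 \<le> (\<Sum>i\<in>UNIV. (xb $ i - y i) \<bullet> (ab $ i - v i))"
      by (simp add: inner_vec_def)
  qed (rule A_max)
  have "bb $ j = B j (tensor_Id R xb $ j)" for j
  proof (rule lipschitz_monotone_test[where B = "B j" and \<beta> = \<beta>])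
    show "norm (B j x - B j y) \<le> \<beta> * norm (x - y)" for x y
      by (rule cocoercive_lipschitz[OF B_cocoercive beta_pos])
    fix y
    \<comment> \<open>Only entry \<open>j\<close> is perturbed and the \<open>A\<close> part is
      tested at \<open>xb\<close> itself, so a single summand of the test remains.\<close>
    define y' where "y' = (\<chi> l. if l = j then y else tensor_Id R xb $ l)"
    have "0 \<le> (tensor_Id R xb - y') \<bullet> (bb - (\<chi> j. B j (y' $ j)))"
      using test[of ab xb y'] ab_mem by simp
    also have "\<dots> = (\<Sum>l\<in>UNIV. if l = j then (tensor_Id R xb $ j - y) \<bullet> (bb $ j - B j y) else 0)"
      unfolding inner_vec_def by (intro sum.cong refl) (simp add: y'_def)
    finally show "0 \<le> (tensor_Id R xb $ j - y) \<bullet> (bb $ j - B j y)"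
      by simp
  qed
  then have "bb = Bv xb"
    by (simp add: Bv_def vec_eq_iff)
  then have "tensor_Id C xb + g *\<^sub>R (ab + tensor_Id P (Bv xb)) = tensor_Id M zb"
    using \<gamma>(3) by (simp add: ab_def)
  with ab_mem have "solves g zb xb"
    unfolding solves_def by blast
  with xb that show ?thesis by simp
qed

end

section \<open>Scalar sequences\<close>

text \<open>Since \<open>1 + \<eta> k \<le> exp (\<eta> k)\<close>, multiplying by the exponential
  of minus the partial sums of \<open>\<eta>\<close> gives a decreasing sequence; undoing this
  convergent factor proves the claim. The shift by \<open>K\<close> skips the indices where the
  estimate may fail.\<close>

lemma quasi_decreasing_convergent:
  fixes D \<eta> :: "nat \<Rightarrow> real"
  assumes ev: "\<forall>\<^sub>F k in sequentially. D (Suc k) \<le> (1 + \<eta> k) * D k"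
    and D: "\<And>k. 0 \<le> D k" and \<eta>: "summable \<eta>"
  shows "convergent D"
proof -
  obtain K where K: "\<And>k. k \<ge> K \<Longrightarrow> D (Suc k) \<le> (1 + \<eta> k) * D k"
    using ev by (auto simp: eventually_sequentially)
  define S where "S n = (\<Sum>i<n + K. \<eta> i)" for n
  define E where "E n = D (n + K) * exp (- S n)" for n
  have "E (Suc n) \<le> E n" for n
  proof -
    have "D (Suc (n + K)) \<le> (1 + \<eta> (n + K)) * D (n + K)"
      by (rule K) simp
    also have "\<dots> \<le> exp (\<eta> (n + K)) * D (n + K)"
      by (intro mult_right_mono D exp_ge_add_one_self)
    finally have "D (Suc (n + K)) * exp (- S (Suc n)) \<le> exp (\<eta> (n + K)) * D (n + K) * exp (- S (Suc n))"
      by (rule mult_right_mono) simp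
    also have "\<dots> = D (n + K) * (exp (\<eta> (n + K)) * exp (- S (Suc n)))"
      by simp
    also have "exp (\<eta> (n + K)) * exp (- S (Suc n)) = exp (- S n)"
      by (simp add: S_def flip: exp_add)
    finally show ?thesis
      by (simp add: E_def)
  qed
  then have "decseq E"
    by (rule decseq_SucI)
  then obtain e where e: "E \<longlonglongrightarrow> e"
    by (rule decseq_convergent[of E 0]) (simp add: E_def D)
  have "(\<lambda>n. \<Sum>i<n. \<eta> i) \<longlonglongrightarrow> suminf \<eta>"
    using \<eta> by (rule summable_LIMSEQ)
  then have "S \<longlonglongrightarrow> suminf \<eta>"
    unfolding S_def[abs_def] by (rule LIMSEQ_ignore_initial_segment)
  then have "(\<lambda>n. E n * exp (S n)) \<longlonglongrightarrow> e * exp (suminf \<eta>)"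
    by (intro tendsto_intros e)
  moreover have "E n * exp (S n) = D (n + K)" for n
    by (simp add: E_def exp_minus)
  ultimately have "(\<lambda>n. D (n + K)) \<longlonglongrightarrow> e * exp (suminf \<eta>)"
    by simp
  then show ?thesis
    unfolding convergent_def using LIMSEQ_offset by blast
qed

text \<open>The absolute value is twice the positive part minus the increment, and the increments
  telescope.\<close>

lemma summable_abs_increments:
  fixes f :: "nat \<Rightarrow> real"
  assumes "f \<longlonglongrightarrow> l" "summable (\<lambda>k. max (f (Suc k) - f k) 0)"
  shows "summable (\<lambda>k. \<bar>f (Suc k) - f k\<bar>)"
proof -
  have "summable (\<lambda>k. 2 * max (f (Suc k) - f k) 0 - (f (Suc k) - f k))"
    by (intro summable_diff summable_mult assms(2) telescope_summable[OF assms(1)])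
  moreover have "2 * max (f (Suc k) - f k) 0 - (f (Suc k) - f k) = \<bar>f (Suc k) - f k\<bar>" for k
    by (simp add: max_def)
  ultimately show ?thesis by simp
qed

lemma positive_limit_bounds:
  fixes f :: "nat \<Rightarrow> real"
  assumes "f \<longlonglongrightarrow> l" "0 < l" "\<And>k. 0 < f k"
  obtains a b where "0 < a" "\<And>k. a \<le> f k" "\<And>k. f k \<le> b"
proof -
  have "Bseq f"
    using assms(1) by (intro convergent_imp_Bseq convergentI)
  then obtain b where b: "\<And>k. norm (f k) \<le> b"
    unfolding Bseq_def by blast
  have "(\<lambda>k. inverse (f k)) \<longlonglongrightarrow> inverse l"
    using assms by (intro tendsto_intros) auto
  then have "Bseq (\<lambda>k. inverse (f k))"
    by (intro convergent_imp_Bseq convergentI)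
  then obtain c where c: "0 < c" "\<And>k. norm (inverse (f k)) \<le> c"
    unfolding Bseq_def by blast
  have "inverse c \<le> f k" for k
    using c(1) c(2)[of k] assms(3)[of k] by (simp add: field_simps)
  moreover have "f k \<le> b" for k
    using b[of k] by simp
  ultimately show ?thesis
    using that[of "inverse c" b] c(1) by simp
qed

section \<open>Weak convergence of the relocated iteration\<close>

context splitting
begin

text \<open>Here \<open>t k\<close> stands for \<open>lam k * \<theta> k\<close>, the combination in
  which these sequences enter the iteration.\<close>

lemma relocated_iteration_weak_convergence:
  fixes \<gamma> t :: "nat \<Rightarrow> real" and z w :: "nat \<Rightarrow> ('a, 'm) vec" and x :: "nat \<Rightarrow> ('a, 'n) vec"
  assumes zer: "zer (sum_op A B) \<noteq> {}"
    and \<gamma>: "\<And>k. 0 < \<gamma> k" "\<gamma> \<longlonglongrightarrow> g" "0 < g" "summable (\<lambda>k. max (\<gamma> (Suc k) - \<gamma> k) 0)"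
    and t: "0 < t0" "\<And>k. t0 \<le> t k"
    and \<mu>: "\<mu> = \<beta> * (spectral_norm ((transpose P - R) ** pinv (transpose M)))\<^sup>2"
    and e: "0 < e" "\<forall>\<^sub>F k in sequentially. e \<le> 2 - \<gamma> k * \<mu> - 2 * t k"
    and x: "\<And>k. x k = X (\<gamma> k) (z k)"
    and w: "\<And>k. w k = z k - t k *\<^sub>R tensor_Id (transpose M) (x k)"
    and z: "\<And>k. z (Suc k) = Q (\<gamma> (Suc k)) (\<gamma> k) (w k)"
  obtains zb c where "solves g zb (const c)"
    "weak_lim z zb sequentially" "weak_lim w zb sequentially" "weak_lim x (const c) sequentially"
proof -
  let ?G = "\<lambda>k. tensor_Id (transpose M) (x k)"
  have sol: "solves (\<gamma> k) (z k) (x k)" for k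
    unfolding x by (rule solves_X) (rule \<gamma>)
  obtain g0 g1 where g0: "0 < g0" "\<And>k. g0 \<le> \<gamma> k" and g1: "\<And>k. \<gamma> k \<le> g1"
    using positive_limit_bounds[OF \<gamma>(2,3,1)] by blast
  obtain K where K0: "0 \<le> K" and K: "\<And>\<gamma> \<delta> w w'. g0 \<le> \<gamma> \<Longrightarrow> \<gamma> \<le> g1 \<Longrightarrow>
      norm (Q \<delta> \<gamma> w - Q \<delta> \<gamma> w') \<le> (1 + K * \<bar>\<delta> - \<gamma>\<bar>) * norm (w - w')"
    using Qmap_lipschitz[OF g0(1)] by blast
  obtain L where L0: "0 \<le> L" and L: "\<And>\<gamma> z x z' x'. 0 < \<gamma> \<Longrightarrow> \<gamma> \<le> g1 \<Longrightarrow> solves \<gamma> z x \<Longrightarrow>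
      solves \<gamma> z' x' \<Longrightarrow> norm (x - x') \<le> L * norm (z - z')"
    using solution_lipschitz by blast
  have t_pos: "0 < t k" for k
    using t(1) t(2)[of k] by simp
  have \<mu>0: "0 \<le> \<mu>"
    using beta_pos by (simp add: \<mu>)
  define \<eta> where "\<eta> k = K * \<bar>\<gamma> (Suc k) - \<gamma> k\<bar>" for k
  have \<eta>0: "0 \<le> \<eta> k" for k
    using K0 by (simp add: \<eta>_def)
  have \<eta>_sum: "summable \<eta>"
    unfolding \<eta>_def[abs_def] by (intro summable_mult summable_abs_increments[OF \<gamma>(2,4)])

  \<comment> \<open>Distances are measured to the relocated copy of \<open>zs\<close> at the current
    step: the update eventually does not increase them, and relocation expands them by at most
    \<open>1 + \<eta> k\<close>.\<close>
  have fejer: "convergent (\<lambda>k. norm (z k - relocated g c zs (\<gamma> k)))" "?G \<longlonglongrightarrow> 0"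
    if zs: "solves g zs (const c)" for zs c
  proof -
    let ?z = "\<lambda>k. relocated g c zs (\<gamma> k)"
    define D where "D k = norm (z k - ?z k)" for k
    define W where "W k = norm (w k - ?z k)" for k
    have DW: "D (Suc k) \<le> (1 + \<eta> k) * W k" for k
      unfolding D_def W_def \<eta>_def z Q_relocated[OF \<gamma>(3,1) zs, symmetric, of "\<gamma> (Suc k)" k]
      by (rule K[OF g0(2) g1])
    have WD: "\<forall>\<^sub>F k in sequentially. (W k)\<^sup>2 \<le> (D k)\<^sup>2 - t0 / 2 * e * (norm (?G k))\<^sup>2"
      using e(2)
    proof eventually_elim
      case (elim k)
      have "(W k)\<^sup>2 \<le> (D k)\<^sup>2 - t k / 2 * (2 - \<gamma> k * \<mu> - 2 * t k) * (norm (?G k))\<^sup>2"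
        unfolding W_def D_def w by (rule solves_descent[OF sol solves_relocated[OF \<gamma>(3,1) zs] \<gamma>(1) t_pos \<mu>])
      moreover have "t0 / 2 * e * (norm (?G k))\<^sup>2 \<le> t k / 2 * (2 - \<gamma> k * \<mu> - 2 * t k) * (norm (?G k))\<^sup>2"
        using elim t e(1) t_pos[of k] by (intro mult_right_mono mult_mono) auto
      ultimately show ?case by linarith
    qed
    have WD': "\<forall>\<^sub>F k in sequentially. W k \<le> D k"
      using WD
    proof eventually_elim
      case (elim k)
      have "0 \<le> t0 / 2 * e * (norm (?G k))\<^sup>2"
        using t(1) e(1) by simp
      with elim have "(W k)\<^sup>2 \<le> (D k)\<^sup>2" by linarith
      then show ?case
        by (rule power2_le_imp_le) (simp add: D_def)
    qed
    have "\<forall>\<^sub>F k in sequentially. D (Suc k) \<le> (1 + \<eta> k) * D k"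
      using WD'
    proof eventually_elim
      case (elim k)
      then have "(1 + \<eta> k) * W k \<le> (1 + \<eta> k) * D k"
        using \<eta>0[of k] by (intro mult_left_mono) auto
      with DW[of k] show ?case by linarith
    qed
    then have conv: "convergent D"
      by (rule quasi_decreasing_convergent) (simp_all add: D_def \<eta>_sum)
    then show "convergent (\<lambda>k. norm (z k - relocated g c zs (\<gamma> k)))"
      by (simp add: D_def[abs_def])
    obtain l where l: "D \<longlonglongrightarrow> l"
      using conv by (auto simp: convergent_def)
    \<comment> \<open>\<open>W k\<close> eventually lies between
      \<open>D (Suc k) / (1 + \<eta> k)\<close> and \<open>D k\<close>, which share the limit
      \<open>l\<close>; so the decrease that dominates the norm of \<open>?G k\<close>
      vanishes.\<close>
    have "W \<longlonglongrightarrow> l"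
    proof (rule tendsto_sandwich)
      have "(\<lambda>k. D (Suc k) / (1 + \<eta> k)) \<longlonglongrightarrow> l / (1 + 0)"
        by (intro tendsto_intros LIMSEQ_Suc[OF l] summable_LIMSEQ_zero[OF \<eta>_sum]) simp
      then show "(\<lambda>k. D (Suc k) / (1 + \<eta> k)) \<longlonglongrightarrow> l" by simp
      have "D (Suc k) / (1 + \<eta> k) \<le> W k" for k
        using DW[of k] \<eta>0[of k] by (simp add: divide_le_eq mult.commute)
      then show "\<forall>\<^sub>F k in sequentially. D (Suc k) / (1 + \<eta> k) \<le> W k" by simp
    qed (use WD' l in auto)
    then have lim: "(\<lambda>k. ((D k)\<^sup>2 - (W k)\<^sup>2) / (t0 / 2 * e)) \<longlonglongrightarrow> (l\<^sup>2 - l\<^sup>2) / (t0 / 2 * e)"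
      using t(1) e(1) by (intro tendsto_intros l) auto
    have "(\<lambda>k. (norm (?G k))\<^sup>2) \<longlonglongrightarrow> 0"
    proof (rule tendsto_sandwich[of "\<lambda>_. 0"])
      show "\<forall>\<^sub>F k in sequentially. (norm (?G k))\<^sup>2 \<le> ((D k)\<^sup>2 - (W k)\<^sup>2) / (t0 / 2 * e)"
        using WD by eventually_elim (use t(1) e(1) in \<open>simp add: field_simps\<close>)
      show "(\<lambda>k. ((D k)\<^sup>2 - (W k)\<^sup>2) / (t0 / 2 * e)) \<longlonglongrightarrow> 0"
        using lim by simp
    qed auto
    from tendsto_real_sqrt[OF this] have "(\<lambda>k. norm (?G k)) \<longlonglongrightarrow> 0"
      by simp
    then show "?G \<longlonglongrightarrow> 0"
      by (rule tendsto_norm_zero_cancel)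
  qed

  \<comment> \<open>Opial's argument needs a target independent of \<open>k\<close>; the relocated
    copies converge to \<open>zs\<close> in norm, so the limit of the distances is
    unaffected.\<close>
  have dist_conv: "convergent (\<lambda>k. norm (z k - zs))" if zs: "solves g zs (const c)" for zs c
  proof -
    obtain l where l: "(\<lambda>k. norm (z k - relocated g c zs (\<gamma> k))) \<longlonglongrightarrow> l"
      using fejer(1)[OF zs] by (auto simp: convergent_def)
    have "(\<lambda>k. norm (relocated g c zs (\<gamma> k) - zs)) \<longlonglongrightarrow> norm (zs - zs)"
      by (intro tendsto_intros tendsto_relocated \<gamma>)
    then have r: "(\<lambda>k. norm (relocated g c zs (\<gamma> k) - zs)) \<longlonglongrightarrow> 0"
      by simp
    have "(\<lambda>k. norm (z k - zs) - norm (z k - relocated g c zs (\<gamma> k))) \<longlonglongrightarrow> 0"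
    proof (rule Lim_null_comparison[OF always_eventually r], rule allI)
      fix k
      show "norm (norm (z k - zs) - norm (z k - relocated g c zs (\<gamma> k))) \<le> norm (relocated g c zs (\<gamma> k) - zs)"
        using norm_triangle_ineq3[of "z k - zs" "z k - relocated g c zs (\<gamma> k)"] by simp
    qed
    from tendsto_add[OF this l] show ?thesis
      by (auto simp: convergent_def)
  qed

  obtain c0 where "c0 \<in> zer (sum_op A B)"
    using zer by blast
  then obtain z0 where z0: "solves g z0 (const c0)"
    using zero_gives_constant_solution by blast
  have G0: "?G \<longlonglongrightarrow> 0"
    by (rule fejer(2)[OF z0])
  obtain Cz where Cz: "\<And>k. norm (z k) \<le> Cz"
  proof -
    obtain b where b: "\<And>k. norm (norm (z k - z0)) \<le> b"
      using convergent_imp_Bseq[OF dist_conv[OF z0]] unfolding Bseq_def by blast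
    have "norm (z k) \<le> b + norm z0" for k
      using b[of k] norm_triangle_ineq[of "z k - z0" z0] by simp
    then show ?thesis by (rule that)
  qed
  \<comment> \<open>\<open>const c0\<close> solves the inclusion at every relocated point, so the
    Lipschitz bound transfers boundedness from \<open>z\<close> to \<open>x\<close>.\<close>
  obtain Cx where Cx: "\<And>k. norm (x k) \<le> Cx"
  proof -
    obtain b where b: "\<And>k. norm (norm (z k - relocated g c0 z0 (\<gamma> k))) \<le> b"
      using convergent_imp_Bseq[OF fejer(1)[OF z0]] unfolding Bseq_def by blast
    have "norm (x k) \<le> L * b + norm (const c0)" for k
    proof -
      have "norm (x k - const c0) \<le> L * norm (z k - relocated g c0 z0 (\<gamma> k))"
        by (rule L[OF \<gamma>(1) g1 sol solves_relocated[OF \<gamma>(3,1) z0]])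
      also have "\<dots> \<le> L * b"
        using b[of k] L0 by (intro mult_left_mono) auto
      finally show ?thesis
        using norm_triangle_ineq[of "x k - const c0" "const c0"] by simp
    qed
    then show ?thesis by (rule that)
  qed
  obtain Cb where Cb: "\<And>k. norm (Bv (x k)) \<le> Cb"
  proof -
    have "norm (Bv (x k)) \<le> \<beta> * spectral_norm R * Cx + norm (Bv 0)" for k
    proof -
      have "norm (Bv (x k) - Bv 0) \<le> \<beta> * spectral_norm R * norm (x k)"
        using Bv_lipschitz[of "x k" 0] by simp
      also have "\<dots> \<le> \<beta> * spectral_norm R * Cx"
        using beta_pos spectral_norm_nonneg[of R] by (intro mult_left_mono Cx) simp
      finally show ?thesis
        using norm_triangle_ineq[of "Bv (x k) - Bv 0" "Bv 0"] by simp
    qed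
    then show ?thesis by (rule that)
  qed

  have cluster: "\<exists>H zb c. H \<le> G \<and> H \<noteq> bot \<and> weak_lim z zb H \<and> weak_lim x (const c) H \<and> solves g zb (const c)"
    if G: "G \<le> sequentially" "G \<noteq> bot" for G
  proof -
    obtain G1 zb where G1: "G1 \<le> G" "G1 \<noteq> bot" "weak_lim z zb G1"
      by (rule bounded_imp_weak_cluster[OF G(2) Cz])
    obtain G2 xb where G2: "G2 \<le> G1" "G2 \<noteq> bot" "weak_lim x xb G2"
      by (rule bounded_imp_weak_cluster[OF G1(2) Cx])
    obtain G3 bb where G3: "G3 \<le> G2" "G3 \<noteq> bot" "weak_lim (\<lambda>k. Bv (x k)) bb G3"
      by (rule bounded_imp_weak_cluster[OF G2(2) Cb])
    have le: "G3 \<le> G1" "G3 \<le> G" "G3 \<le> sequentially"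
      using G1(1) G2(1) G3(1) G(1) by auto
    have zl: "weak_lim z zb G3" and xl: "weak_lim x xb G3"
      by (rule weak_lim_mono[OF G1(3) le(1)], rule weak_lim_mono[OF G2(3) G3(1)])
    obtain c where "xb = const c" "solves g zb (const c)"
      by (rule demiclosed[OF G3(2) \<gamma>(1) tendsto_mono[OF le(3) \<gamma>(2)] \<gamma>(3) sol tendsto_mono[OF le(3) G0]
          zl Cz xl Cx G3(3) Cb])
    with le(2) G3(2) zl xl show ?thesis by blast
  qed
  obtain H0 zb c where H0: "H0 \<le> sequentially" "H0 \<noteq> bot" "weak_lim z zb H0"
      and sol_c: "solves g zb (const c)"
    using cluster[of sequentially] by auto
  have unique: "z1 = zb" "c1 = c"
    if H1: "H1 \<le> sequentially" "H1 \<noteq> bot" "weak_lim z z1 H1" "solves g z1 (const c1)" for H1 z1 c1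
  proof -
    obtain l l1 where l: "(\<lambda>k. norm (z k - zb)) \<longlonglongrightarrow> l" "(\<lambda>k. norm (z k - z1)) \<longlonglongrightarrow> l1"
      using dist_conv[OF sol_c] dist_conv[OF H1(4)] by (auto simp: convergent_def)
    \<comment> \<open>Polarisation expresses the pairing with \<open>zb - z1\<close> through two
      distances that converge along the whole sequence, so both cluster points yield the same
      limit.\<close>
    have zk: "z k \<bullet> (zb - z1) = ((norm zb)\<^sup>2 - (norm z1)\<^sup>2 - ((norm (z k - zb))\<^sup>2 - (norm (z k - z1))\<^sup>2)) / 2" for k
      by (simp add: power2_norm_eq_inner inner_simps inner_commute)
    have lim: "(\<lambda>k. ((norm zb)\<^sup>2 - (norm z1)\<^sup>2 - ((norm (z k - zb))\<^sup>2 - (norm (z k - z1))\<^sup>2)) / 2)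
      \<longlonglongrightarrow> ((norm zb)\<^sup>2 - (norm z1)\<^sup>2 - (l\<^sup>2 - l1\<^sup>2)) / 2"
      by (intro tendsto_intros l) simp
    note lim = lim[folded zk]
    have "zb \<bullet> (zb - z1) = ((norm zb)\<^sup>2 - (norm z1)\<^sup>2 - (l\<^sup>2 - l1\<^sup>2)) / 2"
      by (rule tendsto_unique[OF H0(2) weak_limD[OF H0(3)] tendsto_mono[OF H0(1) lim]])
    moreover have "z1 \<bullet> (zb - z1) = ((norm zb)\<^sup>2 - (norm z1)\<^sup>2 - (l\<^sup>2 - l1\<^sup>2)) / 2"
      by (rule tendsto_unique[OF H1(2) weak_limD[OF H1(3)] tendsto_mono[OF H1(1) lim]])
    ultimately have "(zb - z1) \<bullet> (zb - z1) = 0"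
      by (simp add: inner_diff_left)
    then show eq: "z1 = zb" by simp
    have "const c1 = const c"
      using solves_unique[OF \<gamma>(3)] H1(4) sol_c eq by metis
    then show "c1 = c"
      by (simp add: vec_eq_iff)
  qed
  have sub: "\<exists>H\<le>G. H \<noteq> bot \<and> weak_lim z zb H \<and> weak_lim x (const c) H"
    if G: "G \<le> sequentially" "G \<noteq> bot" for G
  proof -
    obtain H z1 c1 where H: "H \<le> G" "H \<noteq> bot" "weak_lim z z1 H" "weak_lim x (const c1) H" "solves g z1 (const c1)"
      using cluster[OF G] by blast
    moreover have "H \<le> sequentially"
      using H(1) G(1) by (rule order_trans)
    ultimately show ?thesis
      using unique by metis
  qed
  have z_lim: "weak_lim z zb sequentially"
    unfolding weak_lim_def by (intro allI tendsto_if_subfilters) (use sub weak_limD in blast)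
  have x_lim: "weak_lim x (const c) sequentially"
    unfolding weak_lim_def by (intro allI tendsto_if_subfilters) (use sub weak_limD in blast)
  \<comment> \<open>The step condition forces \<open>t k \<le> 1\<close> eventually because
    \<open>\<gamma> k * \<mu>\<close> is nonnegative; thus \<open>w\<close> and \<open>z\<close>
    differ by a null sequence.\<close>
  have tG: "(\<lambda>k. t k *\<^sub>R ?G k) \<longlonglongrightarrow> 0"
  proof (rule Lim_null_comparison)
    show "\<forall>\<^sub>F k in sequentially. norm (t k *\<^sub>R ?G k) \<le> norm (?G k)"
      using e(2)
    proof eventually_elim
      case (elim k)
      have "0 \<le> \<gamma> k * \<mu>"
        using \<gamma>(1)[of k] \<mu>0 by simp
      with elim e(1) have "t k \<le> 1" by linarith
      then show ?case
        using t_pos[of k] by (simp add: mult_left_le_one_le)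
    qed
    show "(\<lambda>k. norm (?G k)) \<longlonglongrightarrow> 0"
      using G0 by (rule tendsto_norm_zero)
  qed
  have "weak_lim w zb sequentially"
    unfolding weak_lim_def
  proof
    fix y
    have "(\<lambda>k. z k \<bullet> y - (t k *\<^sub>R ?G k) \<bullet> y) \<longlonglongrightarrow> zb \<bullet> y - 0 \<bullet> y"
      by (intro tendsto_diff weak_limD[OF z_lim] tendsto_inner tG tendsto_const)
    then show "(\<lambda>k. w k \<bullet> y) \<longlonglongrightarrow> zb \<bullet> y"
      by (simp add: w inner_diff_left)
  qed
  with sol_c z_lim x_lim that show ?thesis by blast
qed

end

theorem theorem4p7:
  fixes A :: "'n::{finite,linorder} \<Rightarrow> 'a::{real_inner,complete_space} \<Rightarrow> 'a set"
    and B :: "'p::{finite,linorder} \<Rightarrow> 'a \<Rightarrow> 'a"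
    and d :: "'n rvec"
    and M :: "('n, 'm::finite) rmat"
    and N :: "('n, 'n) rmat"
    and P :: "('n, 'p) rmat"
    and R :: "('p, 'n) rmat"
    and \<beta> \<mu> \<gamma>bar :: real
    and \<theta> lam \<gamma> :: "nat \<Rightarrow> real"
    and \<Gamma> :: "real set"
    and z w :: "nat \<Rightarrow> ('a, 'm) vec"
    and x :: "nat \<Rightarrow> ('a, 'n) vec"
  assumes "CARD('n) \<ge> 2"
    and "\<And>i. maximally_monotone (A i)"
    and "\<beta> > 0"
    and "\<And>j. cocoercive \<beta> (B j)"
    and "zer (sum_op A B) \<noteq> {}"
    and "\<And>i. d $ i > 0"
    and "{v. transpose M *v v = 0} = range (\<lambda>c. c *\<^sub>R (1 :: 'n rvec))"
    and "transpose P *v 1 = 1"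
    and "R *v 1 = 1"
    and "pos_semidef (2 *\<^sub>R diag_mat d - N - transpose N - M ** transpose M)"
    and "(\<Sum>i\<in>UNIV. \<Sum>j\<in>UNIV. N $ i $ j) = (\<Sum>i\<in>UNIV. d $ i)"
    and "lower_triangular N" and "zero_diagonal N"
    and "lower_triangular P" and "zero_diagonal P"
    and "lower_triangular R"
    and "\<And>k. \<theta> k > 0" and "bounded (range \<theta>)" and "separated_from_zero \<theta>"
    and "\<And>k. lam k > 0" and "separated_from_zero lam"
    and "\<mu> = \<beta> * (spectral_norm ((transpose P - R) ** pinv (transpose M)))\<^sup>2"
    and "\<Gamma> \<subseteq> {g. 0 < g \<and> (\<mu> \<noteq> 0 \<longrightarrow> g < 2 * inverse \<mu>)}"
    and "\<And>k. \<gamma> k \<in> \<Gamma>" and "\<gamma>bar \<in> \<Gamma>" and "\<gamma> \<longlonglongrightarrow> \<gamma>bar"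
    and "summable (\<lambda>k. max (\<gamma> (Suc k) - \<gamma> k) 0)"
    and "liminf (\<lambda>k. ereal (2 - \<gamma> k * \<mu> - 2 * lam k * \<theta> k)) > 0"
    and "\<And>k. x k = xmap A B d M N P R (\<gamma> k) (z k)"
    and "\<And>k. w k = z k - (lam k * \<theta> k) *\<^sub>R tensor_Id (transpose M) (x k)"
    and "\<And>k. z (Suc k) = Qmap A B d M N P R (\<gamma> (Suc k)) (\<gamma> k) (w k)"
  shows "\<exists>zbar xbar.
      zbar \<in> Fix (Tmap A B d M N P R (real_of_ereal (liminf (\<lambda>k. ereal (\<theta> k)))) \<gamma>bar)
    \<and> weakly_convergent_to z zbar
    \<and> weakly_convergent_to w zbar
    \<and> weakly_convergent_to x (\<chi> i. xbar)
    \<and> xbar = resolvent (scale_op (\<gamma>bar / d $ Min UNIV) (A (Min UNIV)))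
               ((1 / d $ Min UNIV) *\<^sub>R (tensor_Id M zbar $ Min UNIV))
    \<and> xbar \<in> zer (sum_op A B)"
proof -
  interpret splitting A B d M N P R \<beta>
    by unfold_locales (fact assms)+
  have \<gamma>_pos: "0 < \<gamma> k" for k
    using assms(23) assms(24)[of k] by blast
  have \<gamma>bar_pos: "0 < \<gamma>bar"
    using assms(23,25) by blast
  obtain a b where ab: "0 < a" "\<And>k. a \<le> \<theta> k" "0 < b" "\<And>k. b \<le> lam k"
    using assms(19,21) unfolding separated_from_zero_def by blast
  have t: "b * a \<le> lam k * \<theta> k" for k
    using ab less_imp_le[OF assms(20)[of k]] by (intro mult_mono) auto
  \<comment> \<open>Any real number strictly between zero and the limit inferior is a uniform margin
    in the step condition from some index on.\<close>
  obtain e where e: "0 < ereal e" "ereal e < liminf (\<lambda>k. ereal (2 - \<gamma> k * \<mu> - 2 * lam k * \<theta> k))"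
    using ereal_dense2[OF assms(28)] by blast
  have "\<forall>\<^sub>F k in sequentially. ereal e < ereal (2 - \<gamma> k * \<mu> - 2 * lam k * \<theta> k)"
    by (rule less_LiminfD[OF e(2)])
  then have e': "\<forall>\<^sub>F k in sequentially. e \<le> 2 - \<gamma> k * \<mu> - 2 * (lam k * \<theta> k)"
    by eventually_elim (simp add: mult.assoc)
  obtain zb c where "solves \<gamma>bar zb (\<chi> i. c)"
    "weak_lim z zb sequentially" "weak_lim w zb sequentially" "weak_lim x (\<chi> i. c) sequentially"
    using relocated_iteration_weak_convergence[OF assms(5) \<gamma>_pos assms(26) \<gamma>bar_pos assms(27) _ t assms(22) _ e' assms(29-31)]
      ab e(1) by auto
  then show ?thesis
    using fixed_point_of_constant_solution[OF \<gamma>bar_pos] constant_solution_is_zero[OF \<gamma>bar_pos]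
    unfolding weakly_convergent_to_def weak_lim_def by blast
qed

end
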